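(* Let $n\ge 2$. Consider the maximal simplices of the noncrossing partition link $\mathrm{Link}(\mathrm{NC}_{n+1})$ whose labels are parking functions $(a_1,\dots,a_n)$ of length $n$ in which no car wants to park in the last parking space, i.e. $a_i\neq n$ for all $i$. These simplices, together with all of their faces, form a contractible subcomplex of $\mathrm{Link}(\mathrm{NC}_{n+1})$.
   Context: Let $P$ be a convex $(n+1)$-gon with vertices labeled $1,\dots,n+1$ in clockwise order. A \emph{noncrossing partition} of $P$ is a partition of its vertex set such that the convex hulls of the blocks are pairwise disjoint. Ordered by refinement ($\pi\le\pi'$ if every block of $\pi$ is contained in a block of $\pi'$), the noncrossing partitions form a bounded graded lattice $\mathrm{NC}_{n+1}$. The \emph{noncrossing partition link} $\mathrm{Link}(\mathrm{NC}_{n+1})$ is the order complex of $\mathrm{NC}_{n+1}$ with its minimum and maximum elements removed; its maximal simplices correspond to the maximal chains of $\mathrm{NC}_{n+1}$. Each noncrossing partition $\pi$ is identified with a permutation of $\{1,\dots,n+1\}$: each vertex $v$ is sent to the next vertex, in clockwise order, of the convex hull of the block of $\pi$ containing $v$. The maximum element corresponds to the cycle $c=(1,2,\dots,n+1)$. Permutations are multiplied as functions (right factor applied first). For a covering relation $\pi<\pi'$, the permutation $\pi'\pi^{-1}$ is a transposition. An $n$-tuple $(a_1,\dots,a_n)$ of positive integers is a \emph{parking function} of length $n$ if, after sorting its entries into weakly increasing order, the $i$-th entry is at most $i$ for each $i$. (In the parking model, the $i$-th car wants to park in space $a_i$ on a one-way street with spaces $1,\dots,n$.) For a maximal chain $\pi_0<\pi_1<\dots<\pi_n$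 of $\mathrm{NC}_{n+1}$, put $t_i=\pi_i\pi_{i-1}^{-1}$, so that $c=t_n\cdots t_1$, and let $a_i$ be the smaller of the two numbers exchanged by $t_i$. Stanley proved that the map sending the chain to $(a_1,\dots,a_n)$ is a bijection from the maximal chains of $\mathrm{NC}_{n+1}$ to the parking functions of length $n$. The parking function of a maximal chain is the label of the corresponding maximal simplex of $\mathrm{Link}(\mathrm{NC}_{n+1})$. *)

theory Defs
  imports "HOL-Analysis.Analysis"
begin

section \<open>Noncrossing partitions of a convex polygon\<close>

text \<open>
  The polygon has vertices \<open>p 1, \<dots>, p m\<close> in the complex plane. The imaginary part below is the
  determinant of the vectors \<open>p j - p i\<close> and \<open>p k - p i\<close>; it is negative iff the triangle
  \<open>p i, p j, p k\<close> is nondegenerate and traversed clockwise. For \<open>m \<ge> 3\<close>, this holds for all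
  \<open>i < j < k\<close> iff the points are the vertices of a convex \<open>m\<close>-gon, listed in clockwise order.
\<close>

definition clockwise_convex_polygon :: "nat \<Rightarrow> (nat \<Rightarrow> complex) \<Rightarrow> bool" where
  "clockwise_convex_polygon m p \<longleftrightarrow>
     (\<forall>i j k. 1 \<le> i \<and> i < j \<and> j < k \<and> k \<le> m \<longrightarrow>
        Im (cnj (p j - p i) * (p k - p i)) < 0)"

definition noncrossing_partitions :: "nat \<Rightarrow> (nat \<Rightarrow> complex) \<Rightarrow> nat set set set" where
  "noncrossing_partitions m p =
     {\<pi>. partition_on {1..m} \<pi> \<and>
         pairwise (\<lambda>B C. disjnt (convex hull (p ` B)) (convex hull (p ` C))) \<pi>}"

definition strictly_refines :: "nat \<Rightarrow> nat set set \<Rightarrow> nat set set \<Rightarrow> bool" where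
  "strictly_refines m \<pi> \<pi>' \<longleftrightarrow> refines {1..m} \<pi> \<pi>' \<and> \<pi> \<noteq> \<pi>'"

definition nc_min :: "nat \<Rightarrow> nat set set" where
  "nc_min m = (\<lambda>v. {v}) ` {1..m}"

definition nc_max :: "nat \<Rightarrow> nat set set" where
  "nc_max m = {{1..m}}"

text \<open>
  As the vertices are labelled clockwise, the vertex following \<open>v\<close> clockwise in the convex hull of
  its block \<open>B\<close> is the next larger element of \<open>B\<close>, or the smallest one if \<open>v\<close> is the largest.
  Numbers outside \<open>{1..m}\<close> are fixed.
\<close>

definition nc_perm :: "nat \<Rightarrow> nat set set \<Rightarrow> nat \<Rightarrow> nat" where
  "nc_perm m \<pi> v =
     (if v \<in> {1..m} then
        (let B = (THE B. B \<in> \<pi> \<and> v \<in> B)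
         in if \<exists>w\<in>B. v < w then Min {w \<in> B. v < w} else Min B)
      else v)"


section \<open>Simplicial complexes\<close>

text \<open>Abstract simplicial complexes, with the convention that simplices are nonempty.\<close>

definition abstract_simplicial_complex :: "'v set set \<Rightarrow> bool" where
  "abstract_simplicial_complex K \<longleftrightarrow>
     (\<forall>\<sigma>\<in>K. finite \<sigma> \<and> \<sigma> \<noteq> {}) \<and> (\<forall>\<sigma>\<in>K. \<forall>\<tau>. \<tau> \<noteq> {} \<and> \<tau> \<subseteq> \<sigma> \<longrightarrow> \<tau> \<in> K)"

definition subcomplex :: "'v set set \<Rightarrow> 'v set set \<Rightarrow> bool" where
  "subcomplex K L \<longleftrightarrow>
     abstract_simplicial_complex K \<and> abstract_simplicial_complex L \<and> K \<subseteq> L"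

definition maximal_simplices :: "'v set set \<Rightarrow> 'v set set" where
  "maximal_simplices L = {\<sigma> \<in> L. \<forall>\<tau>\<in>L. \<sigma> \<subseteq> \<tau> \<longrightarrow> \<tau> = \<sigma>}"

definition with_faces :: "'v set set \<Rightarrow> 'v set set" where
  "with_faces F = {\<tau>. \<tau> \<noteq> {} \<and> (\<exists>\<sigma>\<in>F. \<tau> \<subseteq> \<sigma>)}"

definition order_complex :: "'v set \<Rightarrow> ('v \<Rightarrow> 'v \<Rightarrow> bool) \<Rightarrow> 'v set set" where
  "order_complex V R = {\<sigma>. finite \<sigma> \<and> \<sigma> \<noteq> {} \<and> pred_on.chain V R \<sigma>}"

text \<open>
  The geometric realization in barycentric coordinates. It inherits the product topology of
  \<open>'v \<Rightarrow> real\<close>, which is the usual topology of the realization whenever the complex is finite.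
\<close>

definition realization :: "'v set set \<Rightarrow> ('v \<Rightarrow> real) set" where
  "realization K =
     {x. (\<forall>v. 0 \<le> x v) \<and> {v. x v \<noteq> 0} \<in> K \<and> (\<Sum>v | x v \<noteq> 0. x v) = 1}"

text \<open>The library regards the empty set as contractible, hence the first conjunct.\<close>

definition contractible_complex :: "'v set set \<Rightarrow> bool" where
  "contractible_complex K \<longleftrightarrow> realization K \<noteq> {} \<and> contractible (realization K)"


section \<open>The noncrossing partition link and its labelling by parking functions\<close>

definition nc_link :: "nat \<Rightarrow> (nat \<Rightarrow> complex) \<Rightarrow> nat set set set set" where
  "nc_link m p =
     order_complex (noncrossing_partitions m p - {nc_min m, nc_max m}) (strictly_refines m)"

definition parking_function :: "nat \<Rightarrow> nat list \<Rightarrow> bool" where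
  "parking_function n a \<longleftrightarrow>
     length a = n \<and> (\<forall>x \<in> set a. 0 < x) \<and> (\<forall>i<n. sort a ! i \<le> i + 1)"

text \<open>
  For a list \<open>[\<pi>\<^sub>0, \<dots>, \<pi>\<^sub>n]\<close>, the entry at (zero-based) position \<open>i\<close> is the smallest number moved by
  \<open>\<pi>\<^sub>i\<^sub>+\<^sub>1 \<pi>\<^sub>i\<^sup>-\<^sup>1\<close>. Along a maximal chain this permutation is a transposition.
\<close>

definition chain_label :: "nat \<Rightarrow> nat set set list \<Rightarrow> nat list" where
  "chain_label m \<pi>s =
     map (\<lambda>i. Min {v. (nc_perm m (\<pi>s ! (i + 1)) \<circ> inv (nc_perm m (\<pi>s ! i))) v \<noteq> v})
       [0..<length \<pi>s - 1]"

text \<open>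
  The maximal chain corresponding to a maximal simplex of the link is obtained by adding the minimum
  and the maximum; it is listed here in increasing order.
\<close>

definition simplex_chain :: "nat \<Rightarrow> nat set set set \<Rightarrow> nat set set list" where
  "simplex_chain m \<sigma> =
     (THE \<pi>s. sorted_wrt (strictly_refines m) \<pi>s \<and> set \<pi>s = {nc_min m, nc_max m} \<union> \<sigma>)"

definition simplex_label :: "nat \<Rightarrow> nat set set set \<Rightarrow> nat list" where
  "simplex_label m \<sigma> = chain_label m (simplex_chain m \<sigma>)"

end

theory Submission
  imports Defs
begin

text \<open>
  Sort the noncrossing partitions \<open>x\<close> of \<open>{1..n+1}\<close> into three kinds: either \<open>{n}\<close> is a block of
  \<open>x\<close>, or \<open>n\<close> and \<open>n+1\<close> share a block, or neither holds; call \<open>x\<close> a \<^emph>\<open>detour\<close> in the last case.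
  The first kind is closed under refinement and the second under coarsening. The transposition of a
  covering step that merges two blocks exchanges \<open>n\<close> and \<open>n+1\<close> precisely if one of the two blocks
  is \<open>{n}\<close> and the other contains \<open>n+1\<close> (\<open>label_eq_penultimate_iff\<close>). So the label \<open>n\<close> occurs on
  a maximal chain precisely if the chain jumps from the first kind straight to the second, that is,
  if it contains no detour. Since the label of every maximal chain is a parking function
  (\<open>parking_function_chain_label\<close>), the complex in question is the union of the stars of all detours
  in the link (\<open>avoiding_complex_eq_star_union\<close>).

  More generally, let \<open>\<beta>\<close> be a noncrossing partition in which \<open>n\<close> and \<open>n+1\<close> lie in a common block
  with a third element, and let \<open>K(\<beta>)\<close> be the union of the stars of the detours in the order complex
  of the open interval between the minimum and \<open>\<beta>\<close>. By induction on \<open>\<beta>\<close>, this complex collapses to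
  a cone (\<open>collapsible_star_union_below\<close>); the theorem is the case of the maximum \<open>\<beta>\<close>. Let \<open>k\<close> be
  the largest number below \<open>n\<close> in the block of \<open>n\<close> in \<open>\<beta>\<close>, and let \<open>f x\<close> be obtained from \<open>x\<close> by
  merging the blocks of \<open>k\<close> and \<open>n\<close>. As \<open>k\<close> and \<open>n\<close> are neighbours in a block of \<open>\<beta>\<close>, this is again
  noncrossing (\<open>join_neighbours\<close>). Thus \<open>f\<close> is a closure operator on the interval, except that it
  sends some \<open>x\<close> to \<open>\<beta>\<close> itself. The vertices \<open>x\<close> of \<open>K(\<beta>)\<close> with \<open>f x = \<beta>\<close> are coatoms of the
  interval in which \<open>n\<close> and \<open>n+1\<close> share a block, and the link of such an \<open>x\<close> is \<open>K(x)\<close>, which is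
  collapsible by induction; so these vertices can be deleted. The closure operator then collapses what
  is left to the subcomplex of its fixed points. All fixed points lie above the detour whose only
  block with more than one element is \<open>{k, n}\<close>, so this subcomplex is a cone.

  On the topological side, each collapse is realized by an explicit straight-line deformation
  (\<open>contractible_realization_collapse\<close>).
\<close>

section \<open>Elementary collapses of simplicial complexes\<close>

text \<open>
  The step removes the open star of a simplex \<open>\<tau>\<close> whose link is a cone with apex \<open>v\<close>. For
  \<open>\<tau> = {u}\<close> this deletes a vertex \<open>u\<close> dominated by \<open>v\<close>; if \<open>\<tau>\<close> is a free face of a single simplex
  \<open>\<tau> \<union> {v}\<close>, it is an elementary collapse. Cones are the base case because they contract directly, so
  that they need not be collapsed any further.
\<close>

inductive collapsible :: "'v set set \<Rightarrow> bool" where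
  cone: "collapsible K" if "{v} \<in> K" and "\<And>\<sigma>. \<sigma> \<in> K \<Longrightarrow> insert v \<sigma> \<in> K"
| collapse: "collapsible K" if "\<tau> \<noteq> {}" and "v \<notin> \<tau>"
    and "\<And>\<sigma>. \<sigma> \<in> K \<Longrightarrow> \<tau> \<subseteq> \<sigma> \<Longrightarrow> insert v \<sigma> \<in> K"
    and "collapsible {\<sigma> \<in> K. \<not> \<tau> \<subseteq> \<sigma>}"

lemma realizationD:
  assumes "abstract_simplicial_complex K" "x \<in> realization K"
  shows "\<And>v. 0 \<le> x v" "{v. x v \<noteq> 0} \<in> K" "finite {v. x v \<noteq> 0}" "(\<Sum>v | x v \<noteq> 0. x v) = 1"
  using assms by (auto simp: realization_def abstract_simplicial_complex_def)

text \<open>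
  A point may be tested on any simplex that contains its support, since the support is then a face.
\<close>

lemma realizationI:
  assumes K: "abstract_simplicial_complex K" and s: "\<sigma> \<in> K"
    and x: "\<And>v. 0 \<le> x v" "{v. x v \<noteq> 0} \<subseteq> \<sigma>" "sum x \<sigma> = 1"
  shows "x \<in> realization K"
proof -
  have fin: "finite \<sigma>" using K s by (auto simp: abstract_simplicial_complex_def)
  have sum: "(\<Sum>v | x v \<noteq> 0. x v) = 1"
    using x(3) sum.mono_neutral_left[OF fin x(2), of x] by auto
  then have "{v. x v \<noteq> 0} \<noteq> {}" by (metis sum.empty zero_neq_one)
  then have "{v. x v \<noteq> 0} \<in> K"
    using K s x(2) unfolding abstract_simplicial_complex_def by (metis (no_types, lifting))
  with sum x(1) show ?thesis by (simp add: realization_def)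
qed

lemma continuous_on_Min_coordinates:
  fixes \<tau> :: "'v set"
  assumes "finite \<tau>" "\<tau> \<noteq> {}"
  shows "continuous_on S (\<lambda>x :: 'v \<Rightarrow> real. Min (x ` \<tau>))"
  using assms
proof (induction \<tau> rule: finite_ne_induct)
  case (singleton u)
  have "continuous_on S (\<lambda>x :: 'v \<Rightarrow> real. x u)"
    by (rule continuous_on_subset[OF continuous_on_product_coordinates]) auto
  then show ?case by simp
next
  case (insert u \<tau>)
  have "continuous_on S (\<lambda>x :: 'v \<Rightarrow> real. x u)"
    by (rule continuous_on_subset[OF continuous_on_product_coordinates]) auto
  with insert.IH have "continuous_on S (\<lambda>x :: 'v \<Rightarrow> real. min (x u) (Min (x ` \<tau>)))"
    by (intro continuous_on_min)
  then show ?case using insert.hyps by simp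
qed

lemma continuous_on_snd_coordinate:
  "continuous_on S (\<lambda>z :: 'a :: topological_space \<times> ('v \<Rightarrow> real). snd z u)"
  by (rule continuous_on_compose2[OF continuous_on_product_coordinates])
    (auto intro: continuous_on_snd continuous_on_id)

lemma homotopic_with_canonI:
  fixes h :: "real \<times> 'a :: topological_space \<Rightarrow> 'b :: topological_space"
  assumes "continuous_on ({0..1} \<times> S) h" "\<And>t x. t \<in> {0..1} \<Longrightarrow> x \<in> S \<Longrightarrow> h (t, x) \<in> T"
    and "\<And>x. h (0, x) = f x" "\<And>x. h (1, x) = g x"
  shows "homotopic_with_canon (\<lambda>_. True) S T f g"
  unfolding homotopic_with_def using assms
  by (intro exI[of _ h]) auto

lemma contractible_realization_cone:
  assumes K: "abstract_simplicial_complex K"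
    and v: "{v} \<in> K" and cone: "\<And>\<sigma>. \<sigma> \<in> K \<Longrightarrow> insert v \<sigma> \<in> K"
  shows "contractible_complex K"
proof -
  define e where "e = (\<lambda>u. if u = v then 1 else 0 :: real)"
  define H where "H = (\<lambda>(t, x) u. (1 - t) * x u + t * e u :: real)"
  have e: "e \<in> realization K"
    by (rule realizationI[OF K v]) (auto simp: e_def)
  have "H (t, x) \<in> realization K" if t: "t \<in> {0..1}" and x: "x \<in> realization K" for t x
  proof (rule realizationI[OF K cone[OF realizationD(2)[OF K x]]])
    note xD = realizationD[OF K x]
    have fin: "finite (insert v {v. x v \<noteq> 0})" using xD(3) by simp
    show "0 \<le> H (t, x) u" for u using xD(1)[of u] t by (auto simp: H_def e_def)
    show "{u. H (t, x) u \<noteq> 0} \<subseteq> insert v {v. x v \<noteq> 0}" by (auto simp: H_def e_def)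
    have "sum x (insert v {v. x v \<noteq> 0}) = 1"
      using xD(4) by (subst sum.mono_neutral_right[OF fin, of "{v. x v \<noteq> 0}"]) auto
    moreover have "sum e (insert v {v. x v \<noteq> 0}) = 1"
      unfolding e_def using fin by (subst sum.delta) auto
    ultimately show "sum (H (t, x)) (insert v {v. x v \<noteq> 0}) = 1"
      by (simp only: H_def prod.case sum.distrib flip: sum_distrib_left) simp
  qed
  moreover have "continuous_on ({0..1} \<times> realization K) H"
  proof (rule continuous_on_coordinatewise_then_product)
    fix u
    have "continuous_on ({0..1} \<times> realization K) (\<lambda>z. snd z u)"
      by (rule continuous_on_snd_coordinate)
    then have "continuous_on ({0..1} \<times> realization K) (\<lambda>z. (1 - fst z) * snd z u + fst z * e u)"
      by (intro continuous_intros)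
    then show "continuous_on ({0..1} \<times> realization K) (\<lambda>z. H z u)"
      by (simp add: H_def case_prod_beta)
  qed
  ultimately have "homotopic_with_canon (\<lambda>_. True) (realization K) (realization K) id (\<lambda>_. e)"
    by (intro homotopic_with_canonI[of _ H]) (auto simp: H_def)
  with e show ?thesis unfolding contractible_complex_def contractible_def by blast
qed

text \<open>
  Let \<open>\<mu>(x)\<close> be the smallest barycentric coordinate of \<open>x\<close> at a vertex of \<open>\<tau>\<close>. Subtracting \<open>\<mu>(x)\<close>
  from every coordinate in \<open>\<tau>\<close> and giving the total to \<open>v\<close> pushes \<open>x\<close> off the open star of \<open>\<tau>\<close>, because
  the smallest coordinate becomes \<open>0\<close>. Outside the star \<open>\<mu>(x) = 0\<close> and nothing moves, so the formula
  is continuous on the whole realization; inside the star the straight line from \<open>x\<close> stays in a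
  simplex that contains \<open>\<tau>\<close> and \<open>v\<close>.
\<close>

lemma contractible_realization_collapse:
  fixes K :: "'v set set"
  assumes K: "abstract_simplicial_complex K"
    and t: "\<tau> \<noteq> {}" and v: "v \<notin> \<tau>"
    and ins: "\<And>\<sigma>. \<sigma> \<in> K \<Longrightarrow> \<tau> \<subseteq> \<sigma> \<Longrightarrow> insert v \<sigma> \<in> K"
    and c: "contractible_complex {\<sigma> \<in> K. \<not> \<tau> \<subseteq> \<sigma>}"
  shows "contractible_complex K"
proof (cases "finite \<tau>")
  case False
  have "\<not> \<tau> \<subseteq> \<sigma>" if "\<sigma> \<in> K" for \<sigma>
  proof -
    have "finite \<sigma>" using K that by (simp add: abstract_simplicial_complex_def)
    with False show ?thesis by (metis finite_subset)
  qed
  then have "{\<sigma> \<in> K. \<not> \<tau> \<subseteq> \<sigma>} = K" by blast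
  with c show ?thesis by simp
next
  case fin\<tau>: True
  define L where "L = {\<sigma> \<in> K. \<not> \<tau> \<subseteq> \<sigma>}"
  have L: "abstract_simplicial_complex L"
    unfolding abstract_simplicial_complex_def
  proof (intro conjI ballI allI impI)
    fix \<sigma> assume "\<sigma> \<in> L"
    then have "\<sigma> \<in> K" by (simp add: L_def)
    then show "finite \<sigma>" "\<sigma> \<noteq> {}" using K by (auto simp: abstract_simplicial_complex_def)
  next
    fix \<sigma> \<rho> assume "\<sigma> \<in> L" "\<rho> \<noteq> {} \<and> \<rho> \<subseteq> \<sigma>"
    moreover from this have "\<rho> \<in> K"
      using K unfolding L_def abstract_simplicial_complex_def mem_Collect_eq by metis
    ultimately show "\<rho> \<in> L" unfolding L_def by blast
  qed
  have LK: "realization L \<subseteq> realization K" by (auto simp: L_def realization_def)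
  (* The direction of the deformation; its entries sum to zero. *)
  define d where "d = (\<lambda>u. if u = v then real (card \<tau>) else if u \<in> \<tau> then -1 else 0)"
  define H where "H = (\<lambda>(t, x) u. x u + t * Min (x ` \<tau>) * d u :: real)"
  have H: "H (t, x) \<in> realization K \<and> (t = 1 \<longrightarrow> H (t, x) \<in> realization L)"
    if t: "t \<in> {0..1}" and x: "x \<in> realization K" for t x
  proof -
    note xD = realizationD[OF K x]
    define \<mu> where "\<mu> = Min (x ` \<tau>)"
    have mu_le: "\<mu> \<le> x u" if "u \<in> \<tau>" for u using that fin\<tau> by (simp add: \<mu>_def)
    have "\<mu> \<in> x ` \<tau>" unfolding \<mu>_def using fin\<tau> \<open>\<tau> \<noteq> {}\<close> by (intro Min_in) auto
    then have mu_in: "\<exists>u\<in>\<tau>. x u = \<mu>" by (metis imageE)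
    have mu0: "0 \<le> \<mu>" using mu_in xD(1) by metis
    show ?thesis
    proof (cases "\<mu> = 0")
      case True
      then have "H (t, x) = x" by (auto simp: H_def \<mu>_def)
      moreover have "x \<in> realization L"
        using x mu_in True unfolding realization_def L_def by auto
      ultimately show ?thesis using x by metis
    next
      case False
      let ?s = "{v. x v \<noteq> 0}"
      let ?S = "insert v ?s"
      have sub: "\<tau> \<subseteq> ?s"
      proof
        fix u assume "u \<in> \<tau>"
        then show "u \<in> ?s" using mu_le[of u] mu0 False by auto
      qed
      then have S: "?S \<in> K" using ins[OF xD(2)] by blast
      have fin: "finite ?S" using xD(3) by simp
      have nonneg: "0 \<le> H (t, x) u" for u
      proof -
        have "t * \<mu> \<le> \<mu>" using t mu0 by (simp add: mult_left_le_one_le)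
        then show ?thesis
          using xD(1)[of u] mu_le[of u] t mu0 by (auto simp: H_def d_def \<mu>_def[symmetric])
      qed
      have supp: "{u. H (t, x) u \<noteq> 0} \<subseteq> ?S" using sub by (auto simp: H_def d_def)
      have "sum d ?S = sum d (insert v \<tau>)"
        by (rule sum.mono_neutral_right[OF fin]) (use sub in \<open>auto simp: d_def\<close>)
      also have "\<dots> = real (card \<tau>) + sum d \<tau>" using v fin\<tau> by (simp add: d_def)
      also have "sum d \<tau> = (\<Sum>u\<in>\<tau>. -1)" by (rule sum.cong) (use v in \<open>auto simp: d_def\<close>)
      finally have d0: "sum d ?S = 0" by simp
      have "sum x ?S = 1"
        using xD(4) by (subst sum.mono_neutral_right[OF fin, of ?s]) auto
      with d0 have sum1: "sum (H (t, x)) ?S = 1"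
        by (simp only: H_def prod.case sum.distrib mult_zero_right add_0_right flip: sum_distrib_left)
      have HK: "H (t, x) \<in> realization K" by (rule realizationI[OF K S nonneg supp sum1])
      moreover have "H (t, x) \<in> realization L" if "t = 1"
      proof -
        obtain u where "u \<in> \<tau>" "x u = \<mu>" using mu_in by blast
        then have "H (t, x) u = 0" using v that by (auto simp: H_def d_def \<mu>_def)
        then have "\<not> \<tau> \<subseteq> {u. H (t, x) u \<noteq> 0}" using \<open>u \<in> \<tau>\<close> by blast
        then show ?thesis using HK by (auto simp: realization_def L_def)
      qed
      ultimately show ?thesis by blast
    qed
  qed
  have cont: "continuous_on ({0..1} \<times> realization K) H"
  proof (rule continuous_on_coordinatewise_then_product)
    fix u
    have "continuous_on ({0..1} \<times> realization K) (\<lambda>z. snd z u)"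
      by (rule continuous_on_snd_coordinate)
    moreover have "continuous_on ({0..1::real} \<times> realization K) (\<lambda>z. Min (snd z ` \<tau>))"
      by (rule continuous_on_compose2[OF continuous_on_Min_coordinates[OF fin\<tau> \<open>\<tau> \<noteq> {}\<close>, of UNIV]])
        (auto intro: continuous_on_snd continuous_on_id)
    ultimately have "continuous_on ({0..1} \<times> realization K)
        (\<lambda>z. snd z u + fst z * Min (snd z ` \<tau>) * d u)"
      by (intro continuous_intros)
    then show "continuous_on ({0..1} \<times> realization K) (\<lambda>z. H z u)"
      by (simp add: H_def case_prod_beta)
  qed
  define r where "r = (\<lambda>x. H (1, x))"
  have hom: "homotopic_with_canon (\<lambda>_. True) (realization K) (realization K) id r"
    by (rule homotopic_with_canonI[of _ H]) (use H cont in \<open>auto simp: r_def H_def\<close>)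
  have rL: "r ` realization K \<subseteq> realization L" using H[of 1] by (auto simp: r_def)
  have r_cont: "continuous_on (realization K) r"
    unfolding r_def by (rule continuous_on_compose2[OF cont]) (auto intro!: continuous_intros)
  obtain a where a: "homotopic_with_canon (\<lambda>_. True) (realization L) (realization L) id (\<lambda>_. a)"
    using c by (auto simp: contractible_complex_def contractible_def L_def)
  have "homotopic_with_canon (\<lambda>_. True) (realization K) (realization L) (id \<circ> r) ((\<lambda>_. a) \<circ> r)"
    by (rule homotopic_with_compose_continuous_right[OF a r_cont]) (use rL in auto)
  then have "homotopic_with_canon (\<lambda>_. True) (realization K) (realization K) (id \<circ> r) ((\<lambda>_. a) \<circ> r)"
    using LK by (rule homotopic_with_subset_right)
  then have "homotopic_with_canon (\<lambda>_. True) (realization K) (realization K) r (\<lambda>_. a)"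
    by (simp add: o_def)
  with hom have "contractible (realization K)"
    unfolding contractible_def using homotopic_with_trans by blast
  moreover have "realization K \<noteq> {}"
    using c LK unfolding contractible_complex_def L_def by blast
  ultimately show ?thesis by (simp add: contractible_complex_def)
qed

lemma contractible_collapsible:
  assumes "collapsible K" "abstract_simplicial_complex K"
  shows "contractible_complex K"
  using assms
proof (induction rule: collapsible.induct)
  case (cone v K)
  show ?case by (rule contractible_realization_cone[OF cone(3,1,2)])
next
  case (collapse \<tau> v K)
  have "abstract_simplicial_complex {\<sigma> \<in> K. \<not> \<tau> \<subseteq> \<sigma>}"
    using collapse.prems unfolding abstract_simplicial_complex_def by blast
  then show ?case
    using contractible_realization_collapse[OF collapse.prems collapse.hyps(1-3)] collapse.IH by blast
qed

text \<open>
  A collapse of the link of \<open>v\<close> lifts to the complex: a step for \<open>\<tau>\<close> in the link becomes the step for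
  \<open>\<tau> \<union> {v}\<close> with the same apex. Once the link is a cone, \<open>v\<close> is dominated and can be removed.
\<close>

lemma collapsible_delete_vertex:
  assumes "collapsible L" and "L = {\<sigma>. \<sigma> \<noteq> {} \<and> v \<notin> \<sigma> \<and> insert v \<sigma> \<in> K}"
    and "collapsible {\<sigma> \<in> K. v \<notin> \<sigma>}"
  shows "collapsible K"
  using assms
proof (induction L arbitrary: K rule: collapsible.induct)
  case (cone w L)
  have "w \<noteq> v" using cone(1,3) by auto
  have ins: "insert w \<sigma> \<in> K" if "\<sigma> \<in> K" "{v} \<subseteq> \<sigma>" for \<sigma>
  proof (cases "\<sigma> = {v}")
    case True
    then show ?thesis using cone(1,3) by (auto simp: insert_commute)
  next
    case False
    then have "\<sigma> - {v} \<in> L" using that cone(3) by (auto simp: insert_absorb)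
    then have "insert w (\<sigma> - {v}) \<in> L" by (rule cone(2))
    then have "insert v (insert w (\<sigma> - {v})) \<in> K" using cone(3) by auto
    also have "insert v (insert w (\<sigma> - {v})) = insert w \<sigma>" using that by auto
    finally show ?thesis .
  qed
  show ?case
    using collapsible.collapse[of "{v}" w K] \<open>w \<noteq> v\<close> ins cone(4) by simp
next
  case (collapse \<tau> w L)
  note L = collapse.prems(1)
  show ?case
  proof (cases "\<exists>\<sigma>\<in>L. \<tau> \<subseteq> \<sigma>")
    case False
    then have "{\<sigma> \<in> L. \<not> \<tau> \<subseteq> \<sigma>} = L" by blast
    then show ?thesis using collapse.IH[of K] collapse.prems by simp
  next
    case True
    then have vt: "v \<notin> \<tau>" and wv: "w \<noteq> v" using L collapse.hyps(3) by blast+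
    have ins: "insert w \<sigma> \<in> K" if "\<sigma> \<in> K" "insert v \<tau> \<subseteq> \<sigma>" for \<sigma>
    proof -
      have *: "\<tau> \<subseteq> \<sigma> - {v}" using that vt by auto
      then have "\<sigma> - {v} \<in> L" using that L collapse.hyps(1) by (auto simp: insert_absorb)
      then have "insert w (\<sigma> - {v}) \<in> L" using * by (rule collapse.hyps(3))
      then have "insert v (insert w (\<sigma> - {v})) \<in> K" using L by auto
      also have "insert v (insert w (\<sigma> - {v})) = insert w \<sigma>" using that by auto
      finally show ?thesis .
    qed
    have "collapsible {\<sigma> \<in> K. \<not> insert v \<tau> \<subseteq> \<sigma>}"
    proof (rule collapse.IH)
      show "{\<sigma> \<in> L. \<not> \<tau> \<subseteq> \<sigma>} =
          {\<sigma>. \<sigma> \<noteq> {} \<and> v \<notin> \<sigma> \<and> insert v \<sigma> \<in> {\<sigma> \<in> K. \<not> insert v \<tau> \<subseteq> \<sigma>}}"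
        using L vt by auto
      have "{\<sigma> \<in> {\<sigma> \<in> K. \<not> insert v \<tau> \<subseteq> \<sigma>}. v \<notin> \<sigma>} = {\<sigma> \<in> K. v \<notin> \<sigma>}" by blast
      then show "collapsible {\<sigma> \<in> {\<sigma> \<in> K. \<not> insert v \<tau> \<subseteq> \<sigma>}. v \<notin> \<sigma>}"
        using collapse.prems(2) by simp
    qed
    with wv collapse.hyps(2) ins show ?thesis
      using collapsible.collapse[of "insert v \<tau>" w K] by blast
  qed
qed

section \<open>Unions of vertex stars in the order complex of a poset\<close>

text \<open>
  The order relation is given by inclusion of the sets \<open>r x\<close>. The elements of \<open>Z\<close> that witness that
  a chain lies in a star need not belong to \<open>Q\<close>; so vertices can be removed from \<open>Q\<close> one by one
  while \<open>Z\<close> stays the same.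
\<close>

definition star_union :: "('v \<Rightarrow> 'b set) \<Rightarrow> 'v set \<Rightarrow> 'v set \<Rightarrow> 'v set set" where
  "star_union r Q Z =
     {\<sigma>. \<sigma> \<noteq> {} \<and> \<sigma> \<subseteq> Q \<and> (\<forall>x\<in>\<sigma>. \<forall>y\<in>\<sigma>. r x \<subseteq> r y \<or> r y \<subseteq> r x) \<and>
         (\<exists>z\<in>Z. \<forall>x\<in>\<sigma>. r x \<subseteq> r z \<or> r z \<subseteq> r x)}"

text \<open>
  A non-fixed \<open>x\<close> for which \<open>r x\<close> is maximal is dominated by \<open>f x\<close>: whatever lies above \<open>x\<close> is fixed by
  \<open>f\<close>, hence lies above \<open>f x\<close>. Removing such elements in turn leaves the fixed points, which form a cone
  with apex \<open>a\<close>. The condition on \<open>f x \<in> Z\<close> ensures that a chain stays in the star of some element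
  of \<open>Z\<close> when \<open>f x\<close> is added to it.
\<close>

lemma star_union_closure_operator:
  assumes fin: "finite Q" and inj: "inj_on r Q"
    and clos: "\<And>x. x \<in> Q \<Longrightarrow> f x \<in> Q" "\<And>x. x \<in> Q \<Longrightarrow> r x \<subseteq> r (f x)" "\<And>x. x \<in> Q \<Longrightarrow> f (f x) = f x"
    and mono: "\<And>x y. x \<in> Q \<Longrightarrow> y \<in> Q \<Longrightarrow> r x \<subseteq> r y \<Longrightarrow> r (f x) \<subseteq> r (f y)"
    and a: "a \<in> Q" "a \<in> Z" "f a = a" "\<And>x. x \<in> Q \<Longrightarrow> f x = x \<Longrightarrow> r a \<subseteq> r x"
    and Z: "\<And>x z. x \<in> Q \<Longrightarrow> z \<in> Z \<Longrightarrow> r x \<subseteq> r z \<Longrightarrow> f x \<in> Z"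
  shows "collapsible (star_union r Q Z)"
  using assms
proof (induction "card {x \<in> Q. f x \<noteq> x}" arbitrary: Q rule: less_induct)
  case less
  note fin = less.prems(1) and inj = less.prems(2) and clos = less.prems(3-5) and mono = less.prems(6)
    and a = less.prems(7-10) and Z = less.prems(11)
  let ?N = "{x \<in> Q. f x \<noteq> x}"
  show ?case
  proof (cases "?N = {}")
    case True
    then have le: "r a \<subseteq> r x" if "x \<in> Q" for x using a(4)[of x] that by auto
    show ?thesis
    proof (rule collapsible.cone[of a])
      show "{a} \<in> star_union r Q Z" using a unfolding star_union_def by auto
      fix \<sigma> assume "\<sigma> \<in> star_union r Q Z"
      then have \<sigma>: "\<sigma> \<subseteq> Q" "\<forall>x\<in>\<sigma>. \<forall>y\<in>\<sigma>. r x \<subseteq> r y \<or> r y \<subseteq> r x"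
        unfolding star_union_def by auto
      have "\<forall>x\<in>insert a \<sigma>. r a \<subseteq> r x" using le \<sigma>(1) by auto
      then show "insert a \<sigma> \<in> star_union r Q Z"
        using \<sigma> a(1,2) unfolding star_union_def by auto
    qed
  next
    case False
    have "finite (r ` ?N)" "r ` ?N \<noteq> {}" using fin False by auto
    then obtain x where x: "x \<in> ?N" and max: "\<And>y. y \<in> ?N \<Longrightarrow> r x \<subseteq> r y \<Longrightarrow> r x = r y"
      using finite_has_maximal[of "r ` ?N"] by (metis (no_types, lifting) imageE imageI)
    have xQ: "x \<in> Q" and fx: "f x \<noteq> x" using x by auto
    have above: "r (f x) \<subseteq> r y" if "y \<in> Q" "r x \<subseteq> r y" "y \<noteq> x" for y
    proof -
      have "r x \<noteq> r y" using inj that xQ by (metis inj_onD)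
      then have "f y = y" using max[of y] that by blast
      then show ?thesis using mono[OF xQ that(1,2)] by simp
    qed
    have ins: "insert (f x) \<sigma> \<in> star_union r Q Z" if s: "\<sigma> \<in> star_union r Q Z" "x \<in> \<sigma>" for \<sigma>
    proof -
      obtain z where z: "z \<in> Z" "\<forall>y\<in>\<sigma>. r y \<subseteq> r z \<or> r z \<subseteq> r y"
        and \<sigma>: "\<sigma> \<subseteq> Q" "\<forall>x\<in>\<sigma>. \<forall>y\<in>\<sigma>. r x \<subseteq> r y \<or> r y \<subseteq> r x"
        using s unfolding star_union_def by auto
      have cmp: "r y \<subseteq> r (f x) \<or> r (f x) \<subseteq> r y" if "y \<in> \<sigma>" for y
        using \<sigma> s(2) that above[of y] clos(2)[OF xQ] by blast
      have chain: "\<forall>u\<in>insert (f x) \<sigma>. \<forall>v\<in>insert (f x) \<sigma>. r u \<subseteq> r v \<or> r v \<subseteq> r u"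
        using cmp \<sigma>(2) by auto
      have "\<exists>z\<in>Z. \<forall>y\<in>insert (f x) \<sigma>. r y \<subseteq> r z \<or> r z \<subseteq> r y"
      proof (cases "r x \<subseteq> r z")
        case True
        then have "f x \<in> Z" using Z[OF xQ z(1)] by blast
        then show ?thesis using cmp by (intro bexI[of _ "f x"]) auto
      next
        case False
        then have "r z \<subseteq> r (f x)" using z(2) s(2) clos(2)[OF xQ] by blast
        then show ?thesis using z by (intro bexI[of _ z]) auto
      qed
      then show ?thesis using \<sigma>(1) clos(1)[OF xQ] chain unfolding star_union_def by auto
    qed
    have "{y \<in> Q - {x}. f y \<noteq> y} \<subset> ?N" using x by blast
    then have less': "card {y \<in> Q - {x}. f y \<noteq> y} < card ?N" using fin by (intro psubset_card_mono) auto
    have fne: "f y \<noteq> x" if "y \<in> Q" for y using clos(3)[OF that] fx by metis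
    have "collapsible (star_union r (Q - {x}) Z)"
    proof (rule less.hyps[OF less'])
      show "inj_on r (Q - {x})" using inj by (rule inj_on_subset) auto
      show "a \<in> Q - {x}" using a(1,3) fx by auto
    qed (use fin clos mono a Z fne in \<open>auto\<close>)
    moreover have "{\<sigma> \<in> star_union r Q Z. \<not> {x} \<subseteq> \<sigma>} = star_union r (Q - {x}) Z"
      unfolding star_union_def by auto
    ultimately show ?thesis
      using collapsible.collapse[of "{x}" "f x" "star_union r Q Z"] fx ins by simp
  qed
qed

text \<open>
  As \<open>m \<in> M\<close> is maximal and not in \<open>Z\<close>, the elements of \<open>Z\<close> comparable to \<open>m\<close> lie below it; so the
  link of \<open>m\<close> is again a union of stars, now in the set of elements below \<open>m\<close>.
\<close>

lemma star_union_delete_maximal: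
  assumes "finite M" and "M \<subseteq> Q"
    and "\<And>m x. m \<in> M \<Longrightarrow> x \<in> Q \<union> Z \<Longrightarrow> r m \<subseteq> r x \<Longrightarrow> x = m" and "M \<inter> Z = {}"
    and "\<And>m. m \<in> M \<Longrightarrow> collapsible (star_union r {x \<in> Q. r x \<subset> r m} {z \<in> Z. r z \<subset> r m})"
    and "collapsible (star_union r (Q - M) Z)"
  shows "collapsible (star_union r Q Z)"
  using assms
proof (induction M arbitrary: Q rule: finite_induct)
  case empty
  then show ?case by simp
next
  case (insert m M)
  note sub = insert.prems(1) and max = insert.prems(2) and mZ = insert.prems(3)
    and links = insert.prems(4) and rest = insert.prems(5)
  have "collapsible (star_union r (Q - {m}) Z)"
  proof (rule insert.IH)
    show "M \<subseteq> Q - {m}" "M \<inter> Z = {}" using sub mZ insert.hyps by auto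
    show "x = m'" if "m' \<in> M" "x \<in> Q - {m} \<union> Z" "r m' \<subseteq> r x" for m' x
      using max[of m' x] that by auto
    show "collapsible (star_union r {x \<in> Q - {m}. r x \<subset> r m'} {z \<in> Z. r z \<subset> r m'})" if "m' \<in> M" for m'
    proof -
      have "{x \<in> Q - {m}. r x \<subset> r m'} = {x \<in> Q. r x \<subset> r m'}"
        using max[of m m'] sub that by auto
      then show ?thesis using links[of m'] that by simp
    qed
    show "collapsible (star_union r (Q - {m} - M) Z)"
      using rest by (metis Diff_insert2)
  qed
  moreover have "{\<sigma> \<in> star_union r Q Z. m \<notin> \<sigma>} = star_union r (Q - {m}) Z"
    unfolding star_union_def by auto
  moreover have "star_union r {x \<in> Q. r x \<subset> r m} {z \<in> Z. r z \<subset> r m} =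
      {\<sigma>. \<sigma> \<noteq> {} \<and> m \<notin> \<sigma> \<and> insert m \<sigma> \<in> star_union r Q Z}" (is "?L = ?R")
  proof
    show "?L \<subseteq> ?R"
    proof
      fix \<sigma> assume "\<sigma> \<in> ?L"
      then obtain z where \<sigma>: "\<sigma> \<noteq> {}" "\<sigma> \<subseteq> {x \<in> Q. r x \<subset> r m}"
          "\<forall>x\<in>\<sigma>. \<forall>y\<in>\<sigma>. r x \<subseteq> r y \<or> r y \<subseteq> r x"
        and z: "z \<in> Z" "r z \<subset> r m" "\<forall>x\<in>\<sigma>. r x \<subseteq> r z \<or> r z \<subseteq> r x"
        unfolding star_union_def by auto
      have lt: "\<forall>x\<in>\<sigma>. r x \<subset> r m" using \<sigma>(2) by blast
      have "m \<notin> \<sigma>" using lt by blast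
      moreover have "insert m \<sigma> \<in> star_union r Q Z"
        unfolding star_union_def
      proof (intro CollectI conjI)
        show "insert m \<sigma> \<subseteq> Q" using \<sigma>(2) sub by blast
        show "\<forall>x\<in>insert m \<sigma>. \<forall>y\<in>insert m \<sigma>. r x \<subseteq> r y \<or> r y \<subseteq> r x" using \<sigma>(3) lt by auto
        show "\<exists>z\<in>Z. \<forall>x\<in>insert m \<sigma>. r x \<subseteq> r z \<or> r z \<subseteq> r x"
          using z by (intro bexI[of _ z]) auto
      qed simp
      ultimately show "\<sigma> \<in> ?R" using \<sigma>(1) by simp
    qed
    show "?R \<subseteq> ?L"
    proof
      fix \<sigma> assume "\<sigma> \<in> ?R"
      then obtain z where \<sigma>: "\<sigma> \<noteq> {}" "m \<notin> \<sigma>" "\<sigma> \<subseteq> Q"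
          "\<forall>x\<in>insert m \<sigma>. \<forall>y\<in>insert m \<sigma>. r x \<subseteq> r y \<or> r y \<subseteq> r x"
        and z: "z \<in> Z" "\<forall>x\<in>insert m \<sigma>. r x \<subseteq> r z \<or> r z \<subseteq> r x"
        unfolding star_union_def by auto
      have lt: "r x \<subset> r m" if "x \<in> Q \<union> Z" "x \<noteq> m" "r x \<subseteq> r m \<or> r m \<subseteq> r x" for x
        using max[of m x] that by auto
      have "z \<noteq> m" using z(1) mZ by blast
      then have "r z \<subset> r m" using lt[of z] z by blast
      have s_lt: "r x \<subset> r m" if "x \<in> \<sigma>" for x
      proof (rule lt)
        show "x \<in> Q \<union> Z" "x \<noteq> m" using that \<sigma>(2,3) by auto
        show "r x \<subseteq> r m \<or> r m \<subseteq> r x" using that \<sigma>(4) by simp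
      qed
      show "\<sigma> \<in> ?L"
        unfolding star_union_def
      proof (intro CollectI conjI)
        show "\<sigma> \<subseteq> {x \<in> Q. r x \<subset> r m}" using s_lt \<sigma>(3) by blast
        show "\<forall>x\<in>\<sigma>. \<forall>y\<in>\<sigma>. r x \<subseteq> r y \<or> r y \<subseteq> r x" using \<sigma>(4) by simp
        show "\<exists>z\<in>{z \<in> Z. r z \<subset> r m}. \<forall>x\<in>\<sigma>. r x \<subseteq> r z \<or> r z \<subseteq> r x"
          using z \<open>r z \<subset> r m\<close> by (intro bexI[of _ z]) auto
      qed (use \<sigma>(1) in auto)
    qed
  qed
  ultimately show ?case
    using collapsible_delete_vertex[OF links[of m]] by simp
qed

section \<open>Noncrossing partitions as equivalence relations\<close>

definition block_rel :: "'a set set \<Rightarrow> ('a \<times> 'a) set" where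
  "block_rel \<pi> = {(u, v). \<exists>B\<in>\<pi>. u \<in> B \<and> v \<in> B}"

lemma equiv_block_rel: "partition_on A \<pi> \<Longrightarrow> equiv A (block_rel \<pi>)"
  unfolding block_rel_def by (rule equiv_partition_on)

lemma block_rel_in: "partition_on A \<pi> \<Longrightarrow> (u, v) \<in> block_rel \<pi> \<Longrightarrow> u \<in> A \<and> v \<in> A"
  unfolding block_rel_def partition_on_def by blast

lemma block_rel_refl: "partition_on A \<pi> \<Longrightarrow> u \<in> A \<Longrightarrow> (u, u) \<in> block_rel \<pi>"
  unfolding block_rel_def partition_on_def by blast

lemma block_rel_sym: "(u, v) \<in> block_rel \<pi> \<Longrightarrow> (v, u) \<in> block_rel \<pi>"
  unfolding block_rel_def by blast

lemma block_rel_trans: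
  "partition_on A \<pi> \<Longrightarrow> (u, v) \<in> block_rel \<pi> \<Longrightarrow> (v, w) \<in> block_rel \<pi> \<Longrightarrow> (u, w) \<in> block_rel \<pi>"
  by (meson equivE equiv_block_rel transE)

lemma block_rel_inject:
  assumes "partition_on A \<pi>" "partition_on A \<pi>'" "block_rel \<pi> = block_rel \<pi>'"
  shows "\<pi> = \<pi>'"
proof -
  have "A // block_rel \<pi> = \<pi>" "A // block_rel \<pi>' = \<pi>'"
    unfolding block_rel_def by (rule partition_on_eq_quotient, fact)+
  with assms(3) show ?thesis by argo
qed

lemma refines_iff_block_rel:
  assumes "partition_on A \<pi>" "partition_on A \<pi>'"
  shows "refines A \<pi> \<pi>' \<longleftrightarrow> block_rel \<pi> \<subseteq> block_rel \<pi>'"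
proof
  assume "refines A \<pi> \<pi>'"
  then show "block_rel \<pi> \<subseteq> block_rel \<pi>'" unfolding refines_def block_rel_def by blast
next
  assume sub: "block_rel \<pi> \<subseteq> block_rel \<pi>'"
  have "\<exists>C\<in>\<pi>'. B \<subseteq> C" if B: "B \<in> \<pi>" for B
  proof -
    obtain u where u: "u \<in> B" using partition_onD3[OF assms(1)] B by (metis ex_in_conv)
    then have "(u, u) \<in> block_rel \<pi>'" using B sub unfolding block_rel_def by blast
    then obtain C where C: "C \<in> \<pi>'" "u \<in> C" unfolding block_rel_def by blast
    have "v \<in> C" if "v \<in> B" for v
    proof -
      have "(u, v) \<in> block_rel \<pi>'" using that B u sub unfolding block_rel_def by blast
      then obtain D where "D \<in> \<pi>'" "u \<in> D" "v \<in> D" unfolding block_rel_def by blast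
      then show ?thesis using C partition_onD2[OF assms(2)] unfolding disjoint_def by blast
    qed
    then show ?thesis using C by blast
  qed
  then show "refines A \<pi> \<pi>'" using assms by (simp add: refines_def)
qed

definition block_of :: "'a set set \<Rightarrow> 'a \<Rightarrow> 'a set" where
  "block_of \<pi> u = {w. (u, w) \<in> block_rel \<pi>}"

lemma block_of_eq: "partition_on A \<pi> \<Longrightarrow> B \<in> \<pi> \<Longrightarrow> u \<in> B \<Longrightarrow> block_of \<pi> u = B"
  unfolding block_of_def block_rel_def partition_on_def disjoint_def by blast

lemma block_of_in: "partition_on A \<pi> \<Longrightarrow> u \<in> A \<Longrightarrow> block_of \<pi> u \<in> \<pi>"
  by (metis UnionE block_of_eq partition_onD1)

lemma block_of_self: "partition_on A \<pi> \<Longrightarrow> u \<in> A \<Longrightarrow> u \<in> block_of \<pi> u"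
  unfolding block_of_def using block_rel_refl by fast

definition join_blocks :: "'a set set \<Rightarrow> 'a set \<Rightarrow> 'a set \<Rightarrow> 'a set set" where
  "join_blocks \<pi> B C = insert (B \<union> C) (\<pi> - {B, C})"

lemma partition_on_join_blocks:
  assumes "partition_on A \<pi>" "B \<in> \<pi>" "C \<in> \<pi>"
  shows "partition_on A (join_blocks \<pi> B C)"
proof (rule partition_onI)
  show "\<Union> (join_blocks \<pi> B C) = A"
    unfolding partition_onD1[OF assms(1)] join_blocks_def using assms(2,3) by auto
  have ne: "D \<noteq> {}" if "D \<in> \<pi>" for D using partition_onD3[OF assms(1)] that by metis
  then show "{} \<notin> join_blocks \<pi> B C"
    using assms(2) unfolding join_blocks_def by auto
  have dis: "disjnt D E" if "D \<in> \<pi>" "E \<in> \<pi>" "D \<noteq> E" for D E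
    using partition_onD2[OF assms(1)] that by (simp add: pairwise_def)
  have new: "disjnt (B \<union> C) D" if "D \<in> \<pi> - {B, C}" for D
    using dis[OF assms(2)] dis[OF assms(3)] that by (simp add: disjnt_Un1) metis
  fix D E assume "D \<in> join_blocks \<pi> B C" "E \<in> join_blocks \<pi> B C" "D \<noteq> E"
  then consider "D = B \<union> C" "E \<in> \<pi> - {B, C}" | "E = B \<union> C" "D \<in> \<pi> - {B, C}"
    | "D \<in> \<pi>" "E \<in> \<pi>" unfolding join_blocks_def by blast
  then show "disjnt D E"
  proof cases
    case 2
    then show ?thesis using new[of D] by (simp add: disjnt_sym)
  qed (use new dis \<open>D \<noteq> E\<close> in simp_all)
qed

lemma block_rel_join_blocks:
  assumes "B \<in> \<pi>" "C \<in> \<pi>"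
  shows "block_rel (join_blocks \<pi> B C) = block_rel \<pi> \<union> (B \<union> C) \<times> (B \<union> C)"
  using assms unfolding join_blocks_def block_rel_def by auto

definition noncrossing :: "(nat \<times> nat) set \<Rightarrow> bool" where
  "noncrossing r \<longleftrightarrow>
     (\<forall>a b c d. a < b \<and> b < c \<and> c < d \<and> (a, c) \<in> r \<and> (b, d) \<in> r \<longrightarrow> (a, b) \<in> r)"

text \<open>
  For a convex polygon these are the noncrossing partitions; see \<open>noncrossing_partitions_eq_NC\<close>.
\<close>

definition NC :: "nat \<Rightarrow> nat set set set" where
  "NC m = {\<pi>. partition_on {1..m} \<pi> \<and> noncrossing (block_rel \<pi>)}"

lemma NC_partition: "\<pi> \<in> NC m \<Longrightarrow> partition_on {1..m} \<pi>"
  by (simp add: NC_def)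

lemma finite_NC: "finite (NC m)"
proof (rule finite_subset)
  show "NC m \<subseteq> Pow (Pow {1..m})" unfolding NC_def partition_on_def by blast
qed simp

lemma inj_on_block_rel: "inj_on block_rel (NC m)"
  by (rule inj_onI) (metis NC_partition block_rel_inject)

lemma NC_noncrossing:
  assumes "\<pi> \<in> NC m" "a < b" "b < c" "c < d" "(a, c) \<in> block_rel \<pi>" "(b, d) \<in> block_rel \<pi>"
  shows "(a, b) \<in> block_rel \<pi>"
  using assms unfolding NC_def noncrossing_def by blast

text \<open>
  A symmetric form of the noncrossing condition: one block cannot contain vertices on both sides of a
  diagonal of another.
\<close>

lemma NC_same_side:
  assumes \<pi>: "\<pi> \<in> NC m" and r: "(x, y) \<in> block_rel \<pi>" "(z, w) \<in> block_rel \<pi>" "(x, z) \<notin> block_rel \<pi>"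
  shows "x < z \<and> z < y \<longleftrightarrow> x < w \<and> w < y"
proof -
  have *: False if h: "(x, y) \<in> block_rel \<pi>" "(z, w) \<in> block_rel \<pi>" "(x, z) \<notin> block_rel \<pi>"
    "x < z" "z < y" "\<not> (x < w \<and> w < y)" for x y z w
  proof -
    note tr = block_rel_trans[OF NC_partition[OF \<pi>]]
    have "w \<noteq> x" "w \<noteq> y" using h block_rel_sym tr by metis+
    then consider "y < w" | "w < x" using h by linarith
    then show False
    proof cases
      case 1
      then show False using NC_noncrossing[OF \<pi>, of x z y w] h by blast
    next
      case 2
      then have "(w, x) \<in> block_rel \<pi>"
        using NC_noncrossing[OF \<pi>, of w x z y] h block_rel_sym by metis
      then show False using h block_rel_sym tr by metis
    qed
  qed
  have "(x, w) \<notin> block_rel \<pi>"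
    using r block_rel_sym block_rel_trans[OF NC_partition[OF \<pi>]] by metis
  then show ?thesis using *[of x y z w] *[of x y w z] r block_rel_sym by metis
qed

text \<open>
  Two vertices \<open>u\<close> and \<open>v\<close> that are neighbours in a block of a coarser noncrossing partition \<open>\<rho>\<close> see
  each other: a block of \<open>\<pi>\<close> that separates them would lie outside their block of \<open>\<rho>\<close>, and cross it.
\<close>

lemma join_neighbours:
  assumes \<pi>: "\<pi> \<in> NC m" and \<rho>: "\<rho> \<in> NC m" and sub: "block_rel \<pi> \<subseteq> block_rel \<rho>"
    and uv: "u < v" "(u, v) \<in> block_rel \<rho>" and gap: "\<And>w. u < w \<Longrightarrow> w < v \<Longrightarrow> (u, w) \<notin> block_rel \<rho>"
  defines "\<kappa> \<equiv> join_blocks \<pi> (block_of \<pi> u) (block_of \<pi> v)"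
  shows "\<kappa> \<in> NC m" "block_rel \<kappa> \<subseteq> block_rel \<rho>"
proof -
  let ?r = "block_rel \<pi>" and ?s = "block_rel \<rho>"
  define C where "C = block_of \<pi> u \<union> block_of \<pi> v"
  note part = NC_partition[OF \<pi>]
  note tr = block_rel_trans[OF part] and tr' = block_rel_trans[OF NC_partition[OF \<rho>]]
  note sy = block_rel_sym
  have uv_in: "u \<in> {1..m}" "v \<in> {1..m}" using block_rel_in[OF NC_partition[OF \<rho>] uv(2)] by auto
  have B: "block_of \<pi> u \<in> \<pi>" "block_of \<pi> v \<in> \<pi>" using block_of_in[OF part] uv_in by auto
  have rel: "block_rel \<kappa> = ?r \<union> C \<times> C"
    unfolding \<kappa>_def C_def by (rule block_rel_join_blocks[OF B])
  have C: "w \<in> C \<longleftrightarrow> (u, w) \<in> ?r \<or> (v, w) \<in> ?r" for w by (auto simp: C_def block_of_def)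
  have Cs: "(u, w) \<in> ?s" if "w \<in> C" for w using that sub uv(2) tr' unfolding C by blast
  show "block_rel \<kappa> \<subseteq> ?s"
  proof
    fix z assume "z \<in> block_rel \<kappa>"
    then consider "z \<in> ?r" | a b where "z = (a, b)" "a \<in> C" "b \<in> C" unfolding rel by blast
    then show "z \<in> ?s"
    proof cases
      case 2
      then show ?thesis using Cs sy tr' by metis
    qed (use sub in blast)
  qed
  have C_closed: "b \<in> C" if "a \<in> C" "(a, b) \<in> ?r" for a b using that tr unfolding C by blast
  (* A pair outside C that separates two elements of C would separate u from v, since it separates
     no two elements of a single block of the finer partition. *)
  have no_cross: "(x, z) \<in> ?s \<Longrightarrow> x < z \<and> z < y \<longleftrightarrow> x < w \<and> w < y"
    if xy: "(x, y) \<in> ?r" "x \<notin> C" and zw: "z \<in> C" "w \<in> C" for x y z w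
  proof -
    assume xz: "(x, z) \<in> ?s"
    have y: "y \<notin> C" using xy C_closed sy by metis
    have side: "x < a \<and> a < y \<longleftrightarrow> x < b \<and> b < y" if "a \<in> C" "(a, b) \<in> ?r" for a b
      using NC_same_side[OF \<pi> xy(1) that(2)] that C_closed[of a x] xy(2) sy by metis
    have uC: "u \<in> C" "v \<in> C" unfolding C using block_rel_refl[OF part] uv_in by auto
    have us: "(u, x) \<in> ?s" using Cs[OF zw(1)] xz sy tr' by metis
    have ys: "(u, y) \<in> ?s" using us xy(1) sub tr' by blast
    have "x \<noteq> u" "x \<noteq> v" "y \<noteq> u" "y \<noteq> v" using uC xy(2) y by auto
    moreover have "\<not> (u < x \<and> x < v)" "\<not> (u < y \<and> y < v)" using gap us ys by blast+
    ultimately have "x < u \<and> u < y \<longleftrightarrow> x < v \<and> v < y" using uv(1) by linarith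
    moreover have "x < a \<and> a < y \<longleftrightarrow> x < u \<and> u < y \<or> x < v \<and> v < y" if "a \<in> C" "x < u \<and> u < y \<longleftrightarrow> x < v \<and> v < y" for a
      using that side[OF that(1)] sy unfolding C by metis
    ultimately show ?thesis using zw by metis
  qed
  have "noncrossing (block_rel \<kappa>)" unfolding noncrossing_def
  proof (intro allI impI, elim conjE)
    fix a b c d assume o: "a < b" "b < c" "c < d"
      and ac: "(a, c) \<in> block_rel \<kappa>" and bd: "(b, d) \<in> block_rel \<kappa>"
    have ab: "(a, b) \<in> ?s"
      using NC_noncrossing[OF \<rho> o] ac bd \<open>block_rel \<kappa> \<subseteq> ?s\<close> by blast
    consider "(a, c) \<in> ?r" "(b, d) \<in> ?r" | "a \<in> C" "c \<in> C" "b \<in> C"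
      | "a \<in> C" "c \<in> C" "b \<notin> C" "(b, d) \<in> ?r" | "a \<notin> C" "(a, c) \<in> ?r" "b \<in> C" "d \<in> C"
      using ac bd C_closed sy unfolding rel by blast
    then show "(a, b) \<in> block_rel \<kappa>"
    proof cases
      case 1
      then show ?thesis using NC_noncrossing[OF \<pi> o] unfolding rel by blast
    next
      case 2
      then show ?thesis unfolding rel by blast
    next
      case 3
      then have "b < a \<and> a < d \<longleftrightarrow> b < c \<and> c < d" using no_cross[of b d a c] block_rel_sym[OF ab] by blast
      then show ?thesis using o by linarith
    next
      case 4
      then have "a < b \<and> b < c \<longleftrightarrow> a < d \<and> d < c" using no_cross[of a c b d] ab by blast
      then show ?thesis using o by linarith
    qed
  qed
  then show "\<kappa> \<in> NC m"
    using partition_on_join_blocks[OF part B] by (simp add: NC_def \<kappa>_def)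
qed

lemma nc_min_in_NC: "nc_min m \<in> NC m"
  and block_rel_nc_min: "block_rel (nc_min m) = Id_on {1..m}"
proof -
  show *: "block_rel (nc_min m) = Id_on {1..m}" unfolding nc_min_def block_rel_def by auto
  show "nc_min m \<in> NC m"
    using partition_on_singletons[of "{1..m}"] *
    unfolding NC_def noncrossing_def nc_min_def by force
qed

lemma nc_max_in_NC: "m \<ge> 1 \<Longrightarrow> nc_max m \<in> NC m"
  and block_rel_nc_max: "block_rel (nc_max m) = {1..m} \<times> {1..m}"
proof -
  show *: "block_rel (nc_max m) = {1..m} \<times> {1..m}" unfolding nc_max_def block_rel_def by auto
  show "nc_max m \<in> NC m" if "m \<ge> 1"
    using that partition_on_space[of "{1..m}"] *
    unfolding NC_def noncrossing_def nc_max_def by force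
qed

lemma block_rel_nc_min_le: "\<pi> \<in> NC m \<Longrightarrow> block_rel (nc_min m) \<subseteq> block_rel \<pi>"
  using block_rel_refl[OF NC_partition] by (auto simp: block_rel_nc_min)

lemma block_rel_le_nc_max: "\<pi> \<in> NC m \<Longrightarrow> block_rel \<pi> \<subseteq> block_rel (nc_max m)"
  unfolding block_rel_nc_max by (auto dest!: block_rel_in[OF NC_partition])

section \<open>Convex hulls of vertex sets of a convex polygon\<close>

text \<open>
  Twice the signed area of the triangle \<open>a\<close>, \<open>b\<close>, \<open>z\<close>.
\<close>

definition orient :: "complex \<Rightarrow> complex \<Rightarrow> complex \<Rightarrow> real" where
  "orient a b z = Im (cnj (b - a) * (z - a))"

lemma orient_eq:
  "orient a b z = (Re b - Re a) * (Im z - Im a) - (Im b - Im a) * (Re z - Re a)"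
  by (simp add: orient_def algebra_simps)

lemma orient_rotate: "orient a b z = orient z a b"
  and orient_swap: "orient b a z = - orient a b z"
  and orient_degenerate: "orient a b a = 0" "orient a b b = 0"
  by (simp_all add: orient_eq algebra_simps)

lemma orient_convex_combination:
  "u + v = 1 \<Longrightarrow> orient a b (u *\<^sub>R x + v *\<^sub>R y) = u * orient a b x + v * orient a b y"
proof -
  assume "u + v = 1"
  then have v: "v = 1 - u" by simp
  show ?thesis unfolding v by (simp add: orient_eq algebra_simps)
qed

lemma disjoint_hulls_if_separated:
  assumes S: "\<And>x. x \<in> S \<Longrightarrow> 0 \<le> orient a b x" and T: "\<And>y. y \<in> T \<Longrightarrow> orient a b y < 0"
  shows "disjnt (convex hull S) (convex hull T)"
proof -
  have "convex {x. 0 \<le> orient a b x}"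
    by (rule convexI) (simp add: orient_convex_combination)
  moreover have "convex {x. orient a b x < 0}"
  proof (rule convexI)
    fix x y and u v :: real
    assume xy: "x \<in> {x. orient a b x < 0}" "y \<in> {x. orient a b x < 0}"
      and uv: "0 \<le> u" "0 \<le> v" "u + v = 1"
    have "u * orient a b x \<le> 0" "v * orient a b y \<le> 0"
      using xy uv by (auto simp: mult_le_0_iff)
    moreover have "u * orient a b x < 0 \<or> v * orient a b y < 0"
      using xy uv by (cases "u = 0") (auto simp: mult_less_0_iff)
    ultimately show "u *\<^sub>R x + v *\<^sub>R y \<in> {x. orient a b x < 0}"
      using uv(3) by (auto simp: orient_convex_combination)
  qed
  ultimately have "convex hull S \<subseteq> {x. 0 \<le> orient a b x}" "convex hull T \<subseteq> {x. orient a b x < 0}"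
    using S T by (intro hull_minimal; blast)+
  then show ?thesis unfolding disjnt_def by force
qed

context
  fixes m :: nat and p :: "nat \<Rightarrow> complex"
  assumes polygon: "clockwise_convex_polygon m p"
begin

lemma orient_increasing: "1 \<le> i \<Longrightarrow> i < j \<Longrightarrow> j < k \<Longrightarrow> k \<le> m \<Longrightarrow> orient (p i) (p j) (p k) < 0"
  using polygon unfolding clockwise_convex_polygon_def orient_def by blast

lemma orient_inside:
  assumes "1 \<le> i" "i < j" "j \<le> m" "i \<le> k" "k \<le> j"
  shows "0 \<le> orient (p i) (p j) (p k)"
proof (cases "k = i \<or> k = j")
  case False
  then have "orient (p i) (p k) (p j) < 0" using assms by (intro orient_increasing) auto
  then have "0 < orient (p k) (p i) (p j)" by (simp add: orient_swap[of "p k"])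
  then show ?thesis using orient_rotate[of "p i" "p j" "p k"] by simp
qed (auto simp: orient_degenerate)

lemma orient_outside:
  assumes "1 \<le> i" "i < j" "j \<le> m" "1 \<le> k" "k \<le> m" "k < i \<or> j < k"
  shows "orient (p i) (p j) (p k) < 0"
  using assms orient_increasing[of i j k] orient_increasing[of k i j] orient_rotate[of "p i" "p j" "p k"]
  by auto

text \<open>
  The line through \<open>p i\<close> and \<open>p j\<close> separates the vertices from \<open>i\<close> to \<open>j\<close> from all others.
\<close>

lemma disjoint_hulls_if_interval:
  assumes "1 \<le> i" "i < j" "j \<le> m" "B \<subseteq> {i..j}" "C \<subseteq> {1..m} - {i..j}"
  shows "disjnt (convex hull (p ` B)) (convex hull (p ` C))"
proof (rule disjoint_hulls_if_separated)
  show "0 \<le> orient (p i) (p j) x" if "x \<in> p ` B" for x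
    using that assms orient_inside[of i j] by auto
  show "orient (p i) (p j) y < 0" if "y \<in> p ` C" for y
  proof -
    obtain k where "k \<in> C" "y = p k" using \<open>y \<in> p ` C\<close> by blast
    moreover from this have "k \<in> {1..m} - {i..j}" using assms(5) by blast
    ultimately show ?thesis using orient_outside[of i j k] assms(1-3) by auto
  qed
qed

text \<open>
  As \<open>B\<close> contains the number \<open>Min B\<close> before \<open>C\<close>, it avoids the whole interval from \<open>Min C\<close> to
  \<open>Max C\<close>, and the line through these two vertices separates the hulls. If \<open>C\<close> consists of a single
  vertex, the line through its two neighbours does; a neighbour of the vertex \<open>m\<close> is \<open>1\<close>.
\<close>

lemma disjoint_hulls_if_noncrossing:
  assumes m: "3 \<le> m" and BC: "B \<subseteq> {1..m}" "C \<subseteq> {1..m}" "B \<noteq> {}" "C \<noteq> {}" "B \<inter> C = {}"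
    and nc: "\<And>a b c d. a < b \<Longrightarrow> b < c \<Longrightarrow> c < d \<Longrightarrow> a \<in> B \<Longrightarrow> c \<in> B \<Longrightarrow> b \<in> C \<Longrightarrow> d \<in> C \<Longrightarrow> False"
    and lt: "Min B < Min C"
  shows "disjnt (convex hull (p ` B)) (convex hull (p ` C))"
proof -
  have fin: "finite B" "finite C" using BC finite_subset by blast+
  have mM: "Min B \<in> B" "Min C \<in> C" "Max C \<in> C" using fin BC by auto
  show ?thesis
  proof (cases "Min C = Max C")
    case False
    have "b \<notin> {Min C..Max C}" if "b \<in> B" for b
    proof
      assume "b \<in> {Min C..Max C}"
      moreover have "b \<noteq> Min C" "b \<noteq> Max C" using that mM BC(5) by auto
      ultimately have "Min C < b" "b < Max C" by auto
      then show False using nc[OF lt] that mM by blast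
    qed
    then have "B \<subseteq> {1..m} - {Min C..Max C}" using BC(1) by blast
    moreover have "C \<subseteq> {Min C..Max C}" using fin by auto
    moreover have "Min C < Max C" "1 \<le> Min C" "Max C \<le> m"
      using False mM BC(2) Min_le[OF fin(2) mM(3)] by auto
    ultimately have "disjnt (convex hull (p ` C)) (convex hull (p ` B))"
      by (intro disjoint_hulls_if_interval) auto
    then show ?thesis by (rule disjnt_sym)
  next
    case True
    define c where "c = Min C"
    have "x = c" if "x \<in> C" for x
      unfolding c_def using True Min_le[OF fin(2) that] Max_ge[OF fin(2) that] by linarith
    moreover have cC: "c \<in> C" using mM(2) by (simp add: c_def)
    ultimately have C: "C = {c}" by blast
    have "1 \<le> Min B" using subsetD[OF BC(1) mM(1)] by simp
    then have c: "1 < c" "c \<le> m" using lt subsetD[OF BC(2) cC] by (simp_all add: c_def)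
    have cB: "c \<notin> B" using BC(5) cC by blast
    show ?thesis
    proof (cases "c = m")
      case True
      have "B \<subseteq> {1..m - 1}"
      proof
        fix b assume b: "b \<in> B"
        then have "1 \<le> b" "b \<le> m" "b \<noteq> m" using subsetD[OF BC(1) b] cB True by auto
        then show "b \<in> {1..m - 1}" by simp
      qed
      then show ?thesis using m C True by (intro disjoint_hulls_if_interval[of 1 "m - 1"]) auto
    next
      case False
      show ?thesis
      proof (rule disjoint_hulls_if_separated[of _ "p (c + 1)" "p (c - 1)"])
        show "0 \<le> orient (p (c + 1)) (p (c - 1)) x" if "x \<in> p ` B" for x
        proof -
          obtain b where b: "b \<in> B" "x = p b" using \<open>x \<in> p ` B\<close> by blast
          then have "1 \<le> b" "b \<le> m" "b \<noteq> c" using BC(1) cB by auto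
          have "orient (p (c - 1)) (p (c + 1)) (p b) \<le> 0"
          proof (cases "b = c - 1 \<or> b = c + 1")
            case False
            then have "b < c - 1 \<or> c + 1 < b" using \<open>b \<noteq> c\<close> by linarith
            then show ?thesis
              using c \<open>c \<noteq> m\<close> \<open>1 \<le> b\<close> \<open>b \<le> m\<close> by (intro less_imp_le[OF orient_outside]) auto
          qed (auto simp: orient_degenerate)
          then show ?thesis
            unfolding b(2) orient_swap[where a = "p (c - 1)" and b = "p (c + 1)"] by simp
        qed
        have "orient (p (c - 1)) (p c) (p (c + 1)) < 0" using c False by (intro orient_increasing) auto
        then show "orient (p (c + 1)) (p (c - 1)) y < 0" if "y \<in> p ` C" for y
          using that C orient_rotate[of "p (c - 1)" "p c" "p (c + 1)"] by simp
      qed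
    qed
  qed
qed

text \<open>
  The signed areas of the triangles formed by three of the four vertices are, up to sign, the
  coefficients of the affine dependency between the vertices. As these areas are all negative, the
  dependency expresses one point as a convex combination on either diagonal.
\<close>

lemma diagonals_meet:
  assumes abcd: "1 \<le> a" "a < b" "b < c" "c < d" "d \<le> m"
  shows "\<exists>q. q \<in> convex hull {p a, p c} \<and> q \<in> convex hull {p b, p d}"
proof -
  (* By the sign convention for clockwise polygons, all four numbers are positive. *)
  define \<alpha> where "\<alpha> = - orient (p b) (p c) (p d)"
  define \<beta> where "\<beta> = - orient (p a) (p c) (p d)"
  define \<gamma> where "\<gamma> = - orient (p a) (p b) (p d)"
  define \<delta> where "\<delta> = - orient (p a) (p b) (p c)"
  have pos: "0 < \<alpha>" "0 < \<beta>" "0 < \<gamma>" "0 < \<delta>"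
    using abcd orient_increasing by (auto simp: \<alpha>_def \<beta>_def \<gamma>_def \<delta>_def)
  have sum: "\<alpha> + \<gamma> = \<beta> + \<delta>"
    by (simp add: \<alpha>_def \<beta>_def \<gamma>_def \<delta>_def orient_eq algebra_simps)
  have eq: "\<alpha> *\<^sub>R p a + \<gamma> *\<^sub>R p c = \<beta> *\<^sub>R p b + \<delta> *\<^sub>R p d"
    by (simp add: complex_eq_iff \<alpha>_def \<beta>_def \<gamma>_def \<delta>_def orient_eq algebra_simps)
  define q where "q = (\<alpha> / (\<alpha> + \<gamma>)) *\<^sub>R p a + (\<gamma> / (\<alpha> + \<gamma>)) *\<^sub>R p c"
  have "q = (1 / (\<alpha> + \<gamma>)) *\<^sub>R (\<alpha> *\<^sub>R p a + \<gamma> *\<^sub>R p c)"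
    by (simp add: q_def scaleR_add_right)
  then have q': "q = (\<beta> / (\<alpha> + \<gamma>)) *\<^sub>R p b + (\<delta> / (\<alpha> + \<gamma>)) *\<^sub>R p d"
    unfolding eq by (simp add: scaleR_add_right)
  have hull: "(x / s) *\<^sub>R u + (y / s) *\<^sub>R v \<in> convex hull {u, v}"
    if "0 < x" "0 < y" "s = x + y" for x y s and u v :: complex
    unfolding convex_hull_2 using that
    by (intro CollectI exI[of _ "x / s"] exI[of _ "y / s"]) (simp flip: add_divide_distrib)
  have "q \<in> convex hull {p a, p c}" unfolding q_def by (rule hull[OF pos(1,3) refl])
  moreover have "q \<in> convex hull {p b, p d}" unfolding q' by (rule hull[OF pos(2,4) sum])
  ultimately show ?thesis by blast
qed

theorem noncrossing_partitions_eq_NC: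
  assumes m: "3 \<le> m"
  shows "noncrossing_partitions m p = NC m"
proof -
  have "pairwise (\<lambda>B C. disjnt (convex hull (p ` B)) (convex hull (p ` C))) \<pi> \<longleftrightarrow>
      noncrossing (block_rel \<pi>)" (is "?hulls \<longleftrightarrow> _") if part: "partition_on {1..m} \<pi>" for \<pi>
  proof
    assume hulls: ?hulls
    show "noncrossing (block_rel \<pi>)" unfolding noncrossing_def
    proof (intro allI impI, elim conjE)
      fix a b c d assume o: "a < b" "b < c" "c < d"
        and ac: "(a, c) \<in> block_rel \<pi>" and bd: "(b, d) \<in> block_rel \<pi>"
      obtain B where B: "B \<in> \<pi>" "a \<in> B" "c \<in> B" using ac unfolding block_rel_def by blast
      obtain C where C: "C \<in> \<pi>" "b \<in> C" "d \<in> C" using bd unfolding block_rel_def by blast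
      have "1 \<le> a" "d \<le> m" using block_rel_in[OF part ac] block_rel_in[OF part bd] by auto
      then obtain q where q: "q \<in> convex hull {p a, p c}" "q \<in> convex hull {p b, p d}"
        using diagonals_meet o by blast
      have "convex hull {p a, p c} \<subseteq> convex hull (p ` B)" "convex hull {p b, p d} \<subseteq> convex hull (p ` C)"
        using B C by (auto intro!: hull_mono)
      then have "\<not> disjnt (convex hull (p ` B)) (convex hull (p ` C))"
        using q unfolding disjnt_def by blast
      then have "B = C" using hulls B(1) C(1) unfolding pairwise_def by blast
      then show "(a, b) \<in> block_rel \<pi>" using B C unfolding block_rel_def by blast
    qed
  next
    assume nc: "noncrossing (block_rel \<pi>)"
    have *: "disjnt (convex hull (p ` B)) (convex hull (p ` C))"
      if "B \<in> \<pi>" "C \<in> \<pi>" "B \<noteq> C" "Min B < Min C" for B C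
    proof (rule disjoint_hulls_if_noncrossing[OF m])
      show sub: "B \<subseteq> {1..m}" "C \<subseteq> {1..m}" "B \<noteq> {}" "C \<noteq> {}"
        using part that unfolding partition_on_def by blast+
      show disj: "B \<inter> C = {}" using part that unfolding partition_on_def disjoint_def by blast
      show "Min B < Min C" by (fact that)
      fix a b c d assume "a < b" "b < c" "c < d" "a \<in> B" "c \<in> B" "b \<in> C" "d \<in> C"
      moreover from this have "(a, c) \<in> block_rel \<pi>" "(b, d) \<in> block_rel \<pi>"
        using that unfolding block_rel_def by auto
      ultimately have "(a, b) \<in> block_rel \<pi>" using nc unfolding noncrossing_def by metis
      then have "b \<in> block_of \<pi> a" by (simp add: block_of_def)
      then show False
        using block_of_eq[OF part that(1) \<open>a \<in> B\<close>] disj \<open>b \<in> C\<close> by blast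
    qed
    show ?hulls
    proof (rule pairwiseI)
      fix B C assume BC: "B \<in> \<pi>" "C \<in> \<pi>" "B \<noteq> C"
      have Min: "D \<subseteq> {1..m}" "Min D \<in> D" if "D \<in> \<pi>" for D
      proof -
        show sub: "D \<subseteq> {1..m}" using partition_onD1[OF part] that by blast
        have "D \<noteq> {}" using partition_onD3[OF part] that by metis
        then show "Min D \<in> D" using finite_subset[OF sub] by (intro Min_in) auto
      qed
      have "B \<inter> C = {}" using BC partition_onD2[OF part] by (simp add: disjoint_def)
      then have "Min B \<noteq> Min C" using Min(2)[OF BC(1)] Min(2)[OF BC(2)] by auto
      then consider "Min B < Min C" | "Min C < Min B" by linarith
      then show "disjnt (convex hull (p ` B)) (convex hull (p ` C))"
      proof cases
        case 1
        then show ?thesis using *[OF BC] by blast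
      next
        case 2
        then show ?thesis using *[OF BC(2,1)] BC(3) by (metis disjnt_sym)
      qed
    qed
  qed
  then show ?thesis unfolding noncrossing_partitions_def NC_def by blast
qed

end

section \<open>The union of the stars of the detours is collapsible\<close>

text \<open>
  Given the second condition, the first one says that \<open>{n}\<close> is not a block; see \<open>in_detours_iff\<close>.
\<close>

definition detours :: "nat \<Rightarrow> nat set set set" where
  "detours n = {x \<in> NC (n + 1). (\<exists>w<n. (w, n) \<in> block_rel x) \<and> (n, n + 1) \<notin> block_rel x}"

definition below :: "nat \<Rightarrow> nat set set \<Rightarrow> nat set set set" where
  "below m \<beta> = {x \<in> NC m. x \<noteq> nc_min m \<and> block_rel x \<subset> block_rel \<beta>}"

text \<open>
  Elements that are comparable to no member of \<open>Z\<close> are not vertices of the complex.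
\<close>

lemma star_union_restrict:
  "star_union r Q Z = star_union r {x \<in> Q. \<exists>z\<in>Z. r x \<subseteq> r z \<or> r z \<subseteq> r x} Z"
  unfolding star_union_def by blast

text \<open>
  If \<open>w = k\<close> the claim is clear. Otherwise \<open>w < k\<close>, and the pairs \<open>w, n\<close> and \<open>k, n+1\<close> cross unless
  they lie in one block.
\<close>

lemma no_detour:
  assumes x: "x \<in> NC (n + 1)" and sub: "block_rel x \<subseteq> block_rel \<beta>"
    and gap: "\<And>w. k < w \<Longrightarrow> w < n \<Longrightarrow> (w, n) \<notin> block_rel \<beta>"
    and w: "w < n" "(w, n) \<in> block_rel x" and k: "k < n" "(k, n + 1) \<in> block_rel x"
  shows "(n, n + 1) \<in> block_rel x"
proof -
  note tr = block_rel_trans[OF NC_partition[OF x]]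
  have "w \<le> k" using gap[of w] w sub by (meson not_le subsetD)
  then have "w = k \<or> (w, k) \<in> block_rel x"
    using NC_noncrossing[OF x, of w k n "n + 1"] w k by linarith
  then have "(w, n + 1) \<in> block_rel x" using tr[OF _ k(2), of w] k(2) by blast
  then show ?thesis using tr[OF block_rel_sym[OF w(2)]] by blast
qed

theorem collapsible_star_union_below:
  assumes "\<beta> \<in> NC (n + 1)" "(n, n + 1) \<in> block_rel \<beta>" "w < n" "(w, n) \<in> block_rel \<beta>"
  shows "collapsible (star_union block_rel (below (n + 1) \<beta>) (detours n \<inter> below (n + 1) \<beta>))"
  using assms
proof (induction "card (block_rel \<beta>)" arbitrary: \<beta> w rule: less_induct)
  case less
  note \<beta> = less.prems(1) and nb = less.prems(2)
  let ?r = "block_rel" and ?m = "n + 1"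
  define k where "k = Max {w. w < n \<and> (w, n) \<in> ?r \<beta>}"
  have k_in: "k \<in> {w. w < n \<and> (w, n) \<in> ?r \<beta>}"
    unfolding k_def using less.prems(3,4) by (intro Max_in) auto
  then have k: "k < n" "(k, n) \<in> ?r \<beta>" by auto
  have "finite {w. w < n \<and> (w, n) \<in> ?r \<beta>}" by simp
  then have gap: "(w, n) \<notin> ?r \<beta>" if "k < w" "w < n" for w
    using Max_ge[of "{w. w < n \<and> (w, n) \<in> ?r \<beta>}" w] that unfolding k_def[symmetric] by auto
  then have gap': "(k, w) \<notin> ?r \<beta>" if "k < w" "w < n" for w
    using that block_rel_trans[OF NC_partition[OF \<beta>] block_rel_sym k(2)] by blast
  have kn_in: "k \<in> {1..?m}" "n \<in> {1..?m}" using block_rel_in[OF NC_partition[OF \<beta>] k(2)] by auto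
  define f where "f x = join_blocks x (block_of x k) (block_of x n)" for x
  define Z where "Z = detours n \<inter> below ?m \<beta>"
  define Q where "Q = {x \<in> below ?m \<beta>. \<exists>z\<in>Z. ?r x \<subseteq> ?r z \<or> ?r z \<subseteq> ?r x}"
  (* Only partitions comparable to some detour are vertices. For such x, the value f x = \<beta> forces
     n and n+1 to be in one block already in x; this is what not_n provides. *)
  define M where "M = {x \<in> Q. (n, n + 1) \<in> ?r x \<and> f x = \<beta>}"
  have Q_NC: "x \<in> NC ?m" "?r x \<subset> ?r \<beta>" "x \<noteq> nc_min ?m" if "x \<in> Q" for x
    using that by (auto simp: Q_def below_def)
  have Z_NC: "z \<in> NC ?m" "?r z \<subset> ?r \<beta>" "z \<noteq> nc_min ?m" "\<exists>w<n. (w, n) \<in> ?r z"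
    "(n, n + 1) \<notin> ?r z" if "z \<in> Z" for z
    using that by (auto simp: Z_def below_def detours_def)
  have r_f: "?r (f x) = ?r x \<union> (block_of x k \<union> block_of x n) \<times> (block_of x k \<union> block_of x n)"
    if "x \<in> NC ?m" for x
    unfolding f_def by (intro block_rel_join_blocks block_of_in[OF NC_partition[OF that]] kn_in)
  have f_NC: "f x \<in> NC ?m" "?r (f x) \<subseteq> ?r \<beta>" if "x \<in> NC ?m" "?r x \<subseteq> ?r \<beta>" for x
    unfolding f_def using join_neighbours[OF that(1) \<beta> that(2) k gap'] by auto
  have f_ext: "?r x \<subseteq> ?r (f x)" if "x \<in> NC ?m" for x using r_f[OF that] by blast
  have f_kn: "(k, n) \<in> ?r (f x)" if "x \<in> NC ?m" for x
    using r_f[OF that] block_of_self[OF NC_partition[OF that]] kn_in by blast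
  have f_least: "?r (f x) \<subseteq> ?r y" if x: "x \<in> NC ?m" and y: "y \<in> NC ?m" "?r x \<subseteq> ?r y" "(k, n) \<in> ?r y" for x y
  proof -
    note tr = block_rel_trans[OF NC_partition[OF y(1)]]
    have "(k, a) \<in> ?r y" if "a \<in> block_of x k \<union> block_of x n" for a
      using that y(2,3) tr unfolding block_of_def by blast
    then have "(a, b) \<in> ?r y" if "a \<in> block_of x k \<union> block_of x n" "b \<in> block_of x k \<union> block_of x n" for a b
      using that tr block_rel_sym by metis
    then show ?thesis unfolding r_f[OF x] using y(2) by auto
  qed
  have f_fix: "f x = x" if "x \<in> NC ?m" "?r x \<subseteq> ?r \<beta>" "(k, n) \<in> ?r x" for x
    using inj_onD[OF inj_on_block_rel _ f_NC(1)[OF that(1,2)] that(1)]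
      f_ext[OF that(1)] f_least[OF that(1,1) _ that(3)] by blast
  have not_n: "(n, n + 1) \<notin> ?r (f x)"
    if x: "x \<in> NC ?m" "?r x \<subseteq> ?r \<beta>" "(n, n + 1) \<notin> ?r x" and z: "z \<in> Z" "?r x \<subseteq> ?r z \<or> ?r z \<subseteq> ?r x" for x z
  proof
    assume "(n, n + 1) \<in> ?r (f x)"
    then have kx: "(k, n + 1) \<in> ?r x"
      using x(3) unfolding r_f[OF x(1)] block_of_def by blast
    obtain v where v: "v < n" "(v, n) \<in> ?r z" using Z_NC(4)[OF z(1)] by blast
    show False
    proof (cases "?r x \<subseteq> ?r z")
      case True
      then show False
        using no_detour[OF Z_NC(1)[OF z(1)] _ gap v k(1)] Z_NC(2,5)[OF z(1)] kx by blast
    next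
      case False
      then have "(v, n) \<in> ?r x" using z(2) v(2) by blast
      then show False using no_detour[OF x(1,2) gap v(1) _ k(1) kx] x(3) by blast
    qed
  qed
  have f_Z: "f x \<in> Z" if x: "x \<in> Q" and z: "z \<in> Z" "?r x \<subseteq> ?r z" for x z
  proof -
    have "(n, n + 1) \<notin> ?r x" using z(2) Z_NC(5)[OF z(1)] by blast
    then have "(n, n + 1) \<notin> ?r (f x)" using not_n[of x z] Q_NC[OF x] z by blast
    moreover have "f x \<in> NC ?m" "?r (f x) \<subseteq> ?r \<beta>" using f_NC Q_NC[OF x] by blast+
    moreover have "f x \<noteq> nc_min ?m" using f_kn[OF Q_NC(1)[OF x]] k(1) by (auto simp: block_rel_nc_min)
    ultimately show ?thesis
      using nb f_kn[OF Q_NC(1)[OF x]] k(1) unfolding Z_def detours_def below_def by blast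
  qed
  have f_Q: "f x \<in> Q - M" if x: "x \<in> Q - M" for x
  proof -
    have xQ: "x \<in> Q" using x by blast
    obtain z where z: "z \<in> Z" "?r x \<subseteq> ?r z \<or> ?r z \<subseteq> ?r x" using xQ unfolding Q_def by blast
    have "f x \<noteq> \<beta>"
    proof (cases "(n, n + 1) \<in> ?r x")
      case True
      then show ?thesis using x unfolding M_def by blast
    next
      case False
      then show ?thesis using not_n[of x z] Q_NC[OF xQ] z nb by auto
    qed
    moreover have fN: "f x \<in> NC ?m" "?r (f x) \<subseteq> ?r \<beta>" using f_NC Q_NC[OF xQ] by blast+
    ultimately have "?r (f x) \<subset> ?r \<beta>" using inj_onD[OF inj_on_block_rel _ fN(1) \<beta>] by blast
    moreover have "f x \<noteq> nc_min ?m" using f_kn[OF Q_NC(1)[OF xQ]] k(1) by (auto simp: block_rel_nc_min)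
    moreover have "\<exists>z\<in>Z. ?r (f x) \<subseteq> ?r z \<or> ?r z \<subseteq> ?r (f x)"
    proof (cases "?r x \<subseteq> ?r z")
      case True
      then show ?thesis using f_Z[OF xQ z(1)] by blast
    next
      case False
      then show ?thesis using z f_ext[OF Q_NC(1)[OF xQ]] by blast
    qed
    ultimately have "f x \<in> Q" using fN(1) unfolding Q_def below_def by blast
    moreover have "f (f x) = f x" by (rule f_fix[OF fN f_kn[OF Q_NC(1)[OF xQ]]])
    ultimately show ?thesis using \<open>f x \<noteq> \<beta>\<close> unfolding M_def by auto
  qed
  define a where "a = f (nc_min ?m)"
  have min: "nc_min ?m \<in> NC ?m" "?r (nc_min ?m) \<subseteq> ?r \<beta>"
    using nc_min_in_NC block_rel_nc_min_le[OF \<beta>] by auto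
  have a_NC: "a \<in> NC ?m" "?r a \<subseteq> ?r \<beta>" unfolding a_def using f_NC[OF min] by auto
  have a_kn: "(k, n) \<in> ?r a" unfolding a_def by (rule f_kn[OF min(1)])
  have a_n: "(n, n + 1) \<notin> ?r a"
    unfolding a_def r_f[OF min(1)] block_of_def block_rel_nc_min using k(1) by auto
  have "a \<noteq> nc_min ?m" using a_kn k(1) by (auto simp: block_rel_nc_min)
  then have a_Z: "a \<in> Z" using a_NC a_kn a_n k(1) nb unfolding Z_def detours_def below_def by blast
  then have a_Q: "a \<in> Q - M" using a_n unfolding Q_def Z_def M_def by blast
  have "collapsible (star_union ?r (Q - M) Z)"
  proof (rule star_union_closure_operator[where f = f and a = a])
    have Q_sub: "Q - M \<subseteq> NC ?m" using Q_NC by blast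
    show "finite (Q - M)" using finite_subset[OF Q_sub finite_NC] .
    show "inj_on ?r (Q - M)" using inj_on_subset[OF inj_on_block_rel Q_sub] .
    show "a \<in> Q - M" "a \<in> Z" by (fact a_Q a_Z)+
    show "f a = a" by (rule f_fix[OF a_NC a_kn])
    fix x assume x: "x \<in> Q - M"
    then have xN: "x \<in> NC ?m" "?r x \<subseteq> ?r \<beta>" using Q_NC by blast+
    show "f x \<in> Q - M" by (rule f_Q[OF x])
    show "?r x \<subseteq> ?r (f x)" by (rule f_ext[OF xN(1)])
    show "f (f x) = f x" by (rule f_fix[OF f_NC[OF xN] f_kn[OF xN(1)]])
    show "f x \<in> Z" if "z \<in> Z" "?r x \<subseteq> ?r z" for z using f_Z[of x z] x that by blast
    show "?r a \<subseteq> ?r x" if "f x = x"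
      unfolding a_def using f_least[OF min(1) xN(1) block_rel_nc_min_le[OF xN(1)]] f_kn[OF xN(1)] that
      by simp
    show "?r (f x) \<subseteq> ?r (f y)" if y: "y \<in> Q - M" "?r x \<subseteq> ?r y" for y
    proof -
      have yN: "y \<in> NC ?m" "?r y \<subseteq> ?r \<beta>" using y(1) Q_NC by blast+
      show ?thesis
        by (rule f_least[OF xN(1) f_NC(1)[OF yN] order_trans[OF y(2) f_ext[OF yN(1)]] f_kn[OF yN(1)]])
    qed
  qed
  then have "collapsible (star_union ?r Q Z)"
  proof (rule star_union_delete_maximal[rotated -1])
    show "finite M" unfolding M_def Q_def below_def using finite_NC by simp
    show "M \<subseteq> Q" unfolding M_def by blast
    show "M \<inter> Z = {}" using Z_NC(5) unfolding M_def by blast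
  next
    (* \<beta> arises from y by a single merge, so that nothing lies strictly between them. *)
    fix y x assume y: "y \<in> M" and x: "x \<in> Q \<union> Z" and le: "?r y \<subseteq> ?r x"
    have yN: "y \<in> NC ?m" and fy: "f y = \<beta>" using y Q_NC[of y] unfolding M_def by blast+
    have xN: "x \<in> NC ?m" "?r x \<subset> ?r \<beta>" using x Q_NC[of x] Z_NC[of x] by blast+
    note tr = block_rel_trans[OF NC_partition[OF xN(1)]]
    have kn: "(k, n) \<notin> ?r x" using f_least[OF yN xN(1) le] xN(2) fy by blast
    have "?r x \<subseteq> ?r y"
    proof (rule ccontr)
      assume "\<not> ?r x \<subseteq> ?r y"
      then obtain u v where uv: "(u, v) \<in> ?r x" "(u, v) \<notin> ?r y" by auto
      then have "(u, v) \<in> ?r (f y)" using xN(2) fy by blast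
      then have "u \<in> block_of y k \<union> block_of y n" "v \<in> block_of y k \<union> block_of y n"
        using uv(2) r_f[OF yN] by auto
      moreover have "(u, v) \<in> ?r y" if "(c, u) \<in> ?r y" "(c, v) \<in> ?r y" for c
        using block_rel_trans[OF NC_partition[OF yN] block_rel_sym[OF that(1)] that(2)] .
      ultimately consider "(k, u) \<in> ?r y" "(n, v) \<in> ?r y" | "(n, u) \<in> ?r y" "(k, v) \<in> ?r y"
        using uv(2) unfolding block_of_def by blast
      then show False
      proof cases
        case 1
        then have "(k, u) \<in> ?r x" "(v, n) \<in> ?r x" using le block_rel_sym[of n v x] by auto
        then show False using kn tr[OF tr, of k u v n] uv(1) by simp
      next
        case 2
        then have "(k, v) \<in> ?r x" "(u, n) \<in> ?r x" using le block_rel_sym[of n u x] by auto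
        then show False using kn tr[OF tr, of k v u n] block_rel_sym[OF uv(1)] by simp
      qed
    qed
    then show "x = y" using inj_onD[OF inj_on_block_rel _ xN(1) yN] le by blast
  next
    fix y assume y: "y \<in> M"
    have yQ: "y \<in> Q" and ny: "(n, n + 1) \<in> ?r y" using y unfolding M_def by auto
    note yN = Q_NC[OF yQ]
    obtain z where z: "z \<in> Z" "?r y \<subseteq> ?r z \<or> ?r z \<subseteq> ?r y" using yQ unfolding Q_def by blast
    obtain v where "v < n" "(v, n) \<in> ?r z" using Z_NC(4)[OF z(1)] by blast
    moreover have "?r z \<subseteq> ?r y" using z ny Z_NC(5)[OF z(1)] by blast
    ultimately have v: "v < n" "(v, n) \<in> ?r y" by auto
    have "finite (?r \<beta>)"
      using finite_subset[OF block_rel_le_nc_max[OF \<beta>]] by (simp add: block_rel_nc_max)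
    then have "card (?r y) < card (?r \<beta>)" using yN(2) by (rule psubset_card_mono)
    then have "collapsible (star_union ?r (below ?m y) (detours n \<inter> below ?m y))"
      by (rule less.hyps[OF _ yN(1) ny v])
    moreover have Zy: "detours n \<inter> below ?m y = {z \<in> Z. ?r z \<subset> ?r y}"
      using yN(2) unfolding Z_def below_def by blast
    moreover have "star_union ?r (below ?m y) (detours n \<inter> below ?m y) =
        star_union ?r {x \<in> Q. ?r x \<subset> ?r y} {z \<in> Z. ?r z \<subset> ?r y}"
    proof -
      have eq: "{x \<in> below ?m y. \<exists>z\<in>{z \<in> Z. ?r z \<subset> ?r y}. ?r x \<subseteq> ?r z \<or> ?r z \<subseteq> ?r x} =
          {x \<in> {x \<in> Q. ?r x \<subset> ?r y}. \<exists>z\<in>{z \<in> Z. ?r z \<subset> ?r y}. ?r x \<subseteq> ?r z \<or> ?r z \<subseteq> ?r x}"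
        using yN(2) unfolding Q_def below_def by blast
      show ?thesis
        unfolding Zy star_union_restrict[of ?r "below ?m y"] eq
        by (rule star_union_restrict[symmetric])
    qed
    ultimately show "collapsible (star_union ?r {x \<in> Q. ?r x \<subset> ?r y} {z \<in> Z. ?r z \<subset> ?r y})" by simp
  qed
  moreover have "star_union ?r (below ?m \<beta>) Z = star_union ?r Q Z"
    unfolding Q_def by (rule star_union_restrict)
  ultimately show ?case unfolding Z_def by simp
qed

section \<open>The transposition of a covering step\<close>

definition cyclic_next :: "nat set \<Rightarrow> nat \<Rightarrow> nat" where
  "cyclic_next B v = (if \<exists>w\<in>B. v < w then Min {w \<in> B. v < w} else Min B)"

lemma cyclic_next_in:
  assumes "finite B" "v \<in> B"
  shows "cyclic_next B v \<in> B"
proof (cases "\<exists>w\<in>B. v < w")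
  case True
  then have "Min {w \<in> B. v < w} \<in> {w \<in> B. v < w}" using assms by (intro Min_in) auto
  with True show ?thesis by (simp add: cyclic_next_def)
next
  case False
  moreover have "B \<noteq> {}" using assms(2) by blast
  ultimately show ?thesis using Min_in[OF assms(1)] by (simp add: cyclic_next_def)
qed

lemma cyclic_next_step:
  assumes "finite B" "w \<in> B" "v < w"
  shows "v < cyclic_next B v" "cyclic_next B v \<le> w"
proof -
  have "Min {w \<in> B. v < w} \<in> {w \<in> B. v < w}" using assms by (intro Min_in) auto
  moreover have "Min {w \<in> B. v < w} \<le> w" using assms by (intro Min_le) auto
  ultimately show "v < cyclic_next B v" "cyclic_next B v \<le> w"
    using assms by (auto simp: cyclic_next_def)
qed

lemma cyclic_next_wrap: "\<forall>w\<in>B. w \<le> v \<Longrightarrow> cyclic_next B v = Min B"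
  by (auto simp: cyclic_next_def not_less[symmetric])

lemma inj_on_cyclic_next:
  assumes fin: "finite B"
  shows "inj_on (cyclic_next B) B"
proof -
  have "cyclic_next B u \<noteq> cyclic_next B v" if "u \<in> B" "v \<in> B" "u < v" for u v
  proof (cases "\<exists>w\<in>B. v < w")
    case True
    then show ?thesis
      using cyclic_next_step[OF fin that(2,3)] cyclic_next_step(1)[OF fin] by (metis leD)
  next
    case False
    then have "cyclic_next B v = Min B" by (intro cyclic_next_wrap) auto
    also have "\<dots> \<le> u" using fin that by simp
    finally show ?thesis using cyclic_next_step(1)[OF fin that(2,3)] by linarith
  qed
  then show ?thesis by (metis inj_onI linorder_neqE_nat)
qed

text \<open>Successive next elements run through the whole of \<open>C\<close>.\<close>

lemma cyclic_next_closed_subset: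
  assumes fin: "finite C" and A: "A \<subseteq> C" "A \<noteq> {}"
    and closed: "\<And>u. u \<in> A \<Longrightarrow> cyclic_next C u \<in> A"
  shows "A = C"
proof (rule ccontr)
  assume "A \<noteq> C"
  then have ne: "C - A \<noteq> {}" using A by blast
  have finA: "finite A" using A fin finite_subset by blast
  have max: "Max A \<in> A" using finA A by simp
  have "\<not> Max A < w" if "w \<in> C" for w
    using cyclic_next_step(1)[OF fin that] Max_ge[OF finA closed[OF max]] by fastforce
  then have "cyclic_next C (Max A) = Min C" by (intro cyclic_next_wrap) (auto simp: not_less)
  then have min: "Min C \<in> A" using closed[OF max] by simp
  define c where "c = Min (C - A)"
  have c: "c \<in> C - A" unfolding c_def using fin ne by (intro Min_in) auto
  have "Min C < c" using c min fin Min_le[of C c] by (metis DiffD1 DiffD2 le_neq_implies_less)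
  define b where "b = Max {w \<in> C. w < c}"
  have b: "b \<in> {w \<in> C. w < c}" unfolding b_def
    using fin A(1) min \<open>Min C < c\<close> by (intro Max_in) auto
  have "b \<in> A"
  proof (rule ccontr)
    assume "b \<notin> A"
    then have "c \<le> b" unfolding c_def using b fin by (intro Min_le) auto
    then show False using b by simp
  qed
  moreover have "cyclic_next C b = c"
  proof (rule antisym)
    show "cyclic_next C b \<le> c" using cyclic_next_step(2)[OF fin] b c by blast
    have "b < cyclic_next C b" using cyclic_next_step(1)[OF fin] b c by blast
    moreover have "cyclic_next C b \<in> C" using cyclic_next_in[OF fin] b by blast
    moreover have "w \<le> b" if "w \<in> C" "w < c" for w
      unfolding b_def using that fin by (intro Max_ge) auto
    ultimately show "c \<le> cyclic_next C b" by (meson leD not_le)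
  qed
  ultimately show False using closed c by force
qed

lemma nc_perm_eq:
  assumes "partition_on {1..m} \<pi>"
  shows "nc_perm m \<pi> v = (if v \<in> {1..m} then cyclic_next (block_of \<pi> v) v else v)"
proof -
  have "(THE B. B \<in> \<pi> \<and> v \<in> B) = block_of \<pi> v" if "v \<in> {1..m}"
  proof (rule the_equality)
    show "block_of \<pi> v \<in> \<pi> \<and> v \<in> block_of \<pi> v"
      using block_of_in[OF assms that] block_of_self[OF assms that] by simp
    show "B = block_of \<pi> v" if "B \<in> \<pi> \<and> v \<in> B" for B
      using block_of_eq[OF assms, of B v] that by simp
  qed
  then show ?thesis by (simp add: nc_perm_def cyclic_next_def Let_def)
qed

lemma finite_block_of: "partition_on {1..m :: nat} \<pi> \<Longrightarrow> finite (block_of \<pi> v)"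
  unfolding block_of_def
  by (rule finite_subset[where B = "{1..m}"]) (auto dest: block_rel_in)

lemma nc_perm_block:
  assumes part: "partition_on {1..m} \<pi>" and B: "B \<in> \<pi>" "v \<in> B"
  shows "nc_perm m \<pi> v = cyclic_next B v" "nc_perm m \<pi> v \<in> B"
proof -
  have "v \<in> {1..m}" using B partition_onD1[OF part] by blast
  moreover have "block_of \<pi> v = B" by (rule block_of_eq[OF part B])
  ultimately show *: "nc_perm m \<pi> v = cyclic_next B v" by (simp add: nc_perm_eq[OF part])
  show "nc_perm m \<pi> v \<in> B"
    unfolding * using finite_block_of[OF part, of v] B(2) \<open>block_of \<pi> v = B\<close>
    by (intro cyclic_next_in) auto
qed

lemma bij_nc_perm:
  assumes part: "partition_on {1..m} \<pi>"
  shows "bij (nc_perm m \<pi>)"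
proof -
  have maps: "nc_perm m \<pi> ` {1..m} \<subseteq> {1..m}"
  proof
    fix x assume "x \<in> nc_perm m \<pi> ` {1..m}"
    then obtain v where v: "v \<in> {1..m}" "x = nc_perm m \<pi> v" by blast
    then have "x \<in> block_of \<pi> v"
      using nc_perm_block(2)[OF part block_of_in[OF part v(1)] block_of_self[OF part v(1)]] by simp
    then show "x \<in> {1..m}" unfolding block_of_def using block_rel_in[OF part] by blast
  qed
  have "inj_on (nc_perm m \<pi>) {1..m}"
  proof (rule inj_onI)
    fix u v assume uv: "u \<in> {1..m}" "v \<in> {1..m}" "nc_perm m \<pi> u = nc_perm m \<pi> v"
    note bu = block_of_in[OF part uv(1)] block_of_self[OF part uv(1)]
    note bv = block_of_in[OF part uv(2)] block_of_self[OF part uv(2)]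
    have eq: "block_of \<pi> u = block_of \<pi> v"
      using nc_perm_block(2)[OF part bu] nc_perm_block(2)[OF part bv] uv(3)
        block_of_eq[OF part bu(1)] block_of_eq[OF part bv(1)] by metis
    have "cyclic_next (block_of \<pi> u) u = cyclic_next (block_of \<pi> u) v"
      using nc_perm_block(1)[OF part bu] nc_perm_block(1)[OF part bv] uv(3) eq by simp
    then show "u = v"
      using inj_onD[OF inj_on_cyclic_next[OF finite_block_of[OF part]]] bu(2) bv(2) eq by metis
  qed
  then have "bij_betw (nc_perm m \<pi>) {1..m} {1..m}"
    using maps by (simp add: bij_betw_def endo_inj_surj)
  moreover have "bij_betw (nc_perm m \<pi>) (- {1..m}) (- {1..m})"
    by (rule bij_betw_cong[THEN iffD1, OF _ bij_betw_id])
      (simp add: nc_perm_eq[OF part] del: atLeastAtMost_iff One_nat_def)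
  ultimately have "bij_betw (nc_perm m \<pi>) ({1..m} \<union> - {1..m}) ({1..m} \<union> - {1..m})"
    by (rule bij_betw_combine) simp
  then show ?thesis by simp
qed

text \<open>
  The numbers exchanged by the transposition of a covering step; \<open>chain_label\<close> records their minimum.
\<close>

definition moved :: "nat \<Rightarrow> nat set set \<Rightarrow> nat set set \<Rightarrow> nat set" where
  "moved m \<pi> \<pi>' = {v. (nc_perm m \<pi>' \<circ> inv (nc_perm m \<pi>)) v \<noteq> v}"

lemma moved_eq:
  assumes "partition_on {1..m} \<pi>"
  shows "moved m \<pi> \<pi>' = nc_perm m \<pi> ` {u. nc_perm m \<pi>' u \<noteq> nc_perm m \<pi> u}"
proof -
  have b: "bij (nc_perm m \<pi>)" by (rule bij_nc_perm[OF assms])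
  have 1: "inv (nc_perm m \<pi>) (nc_perm m \<pi> u) = u" for u
    using b by (simp add: bij_is_inj)
  have 2: "nc_perm m \<pi> (inv (nc_perm m \<pi>) v) = v" for v
    using b by (simp add: bij_is_surj surj_f_inv_f)
  show ?thesis
  proof
    show "moved m \<pi> \<pi>' \<subseteq> nc_perm m \<pi> ` {u. nc_perm m \<pi>' u \<noteq> nc_perm m \<pi> u}"
    proof
      fix v assume "v \<in> moved m \<pi> \<pi>'"
      then show "v \<in> nc_perm m \<pi> ` {u. nc_perm m \<pi>' u \<noteq> nc_perm m \<pi> u}"
        using 2[of v] by (intro image_eqI[of _ _ "inv (nc_perm m \<pi>) v"]) (auto simp: moved_def)
    qed
  qed (auto simp: moved_def 1)
qed

context
  fixes m :: nat and \<pi> :: "nat set set" and A B :: "nat set"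
  assumes part: "partition_on {1..m} \<pi>" and A: "A \<in> \<pi>" and B: "B \<in> \<pi>" and AB: "A \<noteq> B"
begin

lemma merged_blocks:
  shows "A \<subseteq> {1..m}" "B \<subseteq> {1..m}" "finite A" "finite B" "A \<noteq> {}" "B \<noteq> {}" "A \<inter> B = {}"
proof -
  show sub: "A \<subseteq> {1..m}" "B \<subseteq> {1..m}" using A B partition_onD1[OF part] by blast+
  show "finite A" "finite B" using sub finite_subset by blast+
  show "A \<noteq> {}" "B \<noteq> {}" using A B partition_onD3[OF part] by auto
  show "A \<inter> B = {}" using A B AB partition_onD2[OF part] unfolding disjoint_def by blast
qed

text \<open>
  An element is moved if its predecessor in its old block is not its predecessor in the merged block.
\<close>

lemma in_moved_iff:
  "v \<in> moved m \<pi> (join_blocks \<pi> A B) \<longleftrightarrow>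
     (\<exists>u. (u \<in> A \<and> v = cyclic_next A u \<or> u \<in> B \<and> v = cyclic_next B u) \<and> cyclic_next (A \<union> B) u \<noteq> v)"
proof -
  let ?\<pi>' = "join_blocks \<pi> A B"
  have part': "partition_on {1..m} ?\<pi>'" by (rule partition_on_join_blocks[OF part A B])
  have new: "nc_perm m ?\<pi>' u = cyclic_next (A \<union> B) u" if "u \<in> A \<union> B" for u
    using that by (intro nc_perm_block(1)[OF part']) (auto simp: join_blocks_def)
  have old: "nc_perm m ?\<pi>' u = nc_perm m \<pi> u" if "u \<notin> A \<union> B" for u
  proof (cases "u \<in> {1..m}")
    case True
    note bu = block_of_in[OF part True] block_of_self[OF part True]
    then have "block_of \<pi> u \<in> ?\<pi>'" using that unfolding join_blocks_def by auto
    then show ?thesis using nc_perm_block(1)[OF part' _ bu(2)] nc_perm_block(1)[OF part bu] by simp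
  qed (simp add: nc_perm_eq[OF part] nc_perm_eq[OF part'] del: atLeastAtMost_iff One_nat_def)
  have "v \<in> moved m \<pi> ?\<pi>' \<longleftrightarrow> (\<exists>u. v = nc_perm m \<pi> u \<and> nc_perm m ?\<pi>' u \<noteq> nc_perm m \<pi> u)"
    unfolding moved_eq[OF part] by blast
  also have "\<dots> \<longleftrightarrow> (\<exists>u\<in>A \<union> B. v = nc_perm m \<pi> u \<and> cyclic_next (A \<union> B) u \<noteq> v)"
    using new old by metis
  also have "\<dots> \<longleftrightarrow> (\<exists>u. (u \<in> A \<and> v = cyclic_next A u \<or> u \<in> B \<and> v = cyclic_next B u)
      \<and> cyclic_next (A \<union> B) u \<noteq> v)"
    using nc_perm_block(1)[OF part A] nc_perm_block(1)[OF part B] by (metis Un_iff)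
  finally show ?thesis .
qed

lemma moved_subset: "moved m \<pi> (join_blocks \<pi> A B) \<subseteq> A \<union> B"
  using merged_blocks cyclic_next_in by (auto simp: in_moved_iff)

text \<open>
  Otherwise \<open>A\<close> would be closed under passing to the next element of \<open>A \<union> B\<close>.
\<close>

lemma moved_meets: "moved m \<pi> (join_blocks \<pi> A B) \<inter> A \<noteq> {}"
proof -
  obtain u where "u \<in> A" "cyclic_next (A \<union> B) u \<notin> A"
    using cyclic_next_closed_subset[of "A \<union> B" A] merged_blocks by blast
  then have "cyclic_next A u \<in> moved m \<pi> (join_blocks \<pi> A B)" "cyclic_next A u \<in> A"
    using cyclic_next_in[of A u] merged_blocks(3) unfolding in_moved_iff by metis+
  then show ?thesis by blast
qed

lemma Min_moved_in: "Min (moved m \<pi> (join_blocks \<pi> A B)) \<in> moved m \<pi> (join_blocks \<pi> A B)"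
  using moved_meets finite_subset[OF moved_subset] merged_blocks(3,4) by (intro Min_in) auto

lemma Min_moved_le: "v \<in> moved m \<pi> (join_blocks \<pi> A B) \<Longrightarrow> Min (moved m \<pi> (join_blocks \<pi> A B)) \<le> v"
  using finite_subset[OF moved_subset] merged_blocks(3,4) by (intro Min_le) auto

lemma Min_moved_singleton:
  assumes "A = {n}" "n + 1 \<in> B"
  shows "Min (moved m \<pi> (join_blocks \<pi> A B)) = n"
proof (rule antisym)
  have "n < cyclic_next (A \<union> B) n"
    using cyclic_next_step(1)[of "A \<union> B" "n + 1" n] assms merged_blocks(4) by auto
  moreover have "cyclic_next A n = n" using assms(1) by (simp add: cyclic_next_def)
  ultimately have "n \<in> moved m \<pi> (join_blocks \<pi> A B)" unfolding in_moved_iff using assms(1) by force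
  then show "Min (moved m \<pi> (join_blocks \<pi> A B)) \<le> n" by (rule Min_moved_le)
next
  show "n \<le> Min (moved m \<pi> (join_blocks \<pi> A B))"
  proof (rule ccontr)
    let ?v = "Min (moved m \<pi> (join_blocks \<pi> A B))"
    assume lt: "\<not> n \<le> ?v"
    obtain u where u: "u \<in> A \<and> ?v = cyclic_next A u \<or> u \<in> B \<and> ?v = cyclic_next B u"
        "cyclic_next (A \<union> B) u \<noteq> ?v"
      using Min_moved_in unfolding in_moved_iff by metis
    have "u \<in> B" "?v = cyclic_next B u" using u(1) lt assms(1) by (auto simp: cyclic_next_def)
    note finB = merged_blocks(4)
    have "cyclic_next (A \<union> B) u = cyclic_next B u"
    proof (cases "\<exists>w\<in>B. u < w")
      case True
      then obtain w where w: "w \<in> B" "u < w" by blast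
      have un: "u < n" using cyclic_next_step(1)[OF finB w] lt \<open>?v = cyclic_next B u\<close> by linarith
      have fin: "finite {w \<in> B. u < w}" "{w \<in> B. u < w} \<noteq> {}" using finB w by auto
      have "cyclic_next (A \<union> B) u = Min (insert n {w \<in> B. u < w})"
        using un assms(1) by (auto simp: cyclic_next_def intro!: arg_cong[where f = Min])
      also have "\<dots> = min n (cyclic_next B u)"
        using fin True by (simp add: cyclic_next_def)
      finally show ?thesis using lt \<open>?v = cyclic_next B u\<close> by simp
    next
      case False
      then have "n + 1 \<le> u" using assms(2) by (meson not_le)
      then have "cyclic_next (A \<union> B) u = Min (insert n B)"
        using False assms(1) by (simp add: cyclic_next_def)
      also have "\<dots> = min n (Min B)" using finB merged_blocks(6) by simp
      also have "Min B = cyclic_next B u" using False by (simp add: cyclic_next_def)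
      finally show ?thesis using lt \<open>?v = cyclic_next B u\<close> by simp
    qed
    then show False using u(2) \<open>?v = cyclic_next B u\<close> by simp
  qed
qed

text \<open>
  If \<open>A\<close> had another element, the predecessor \<open>u\<close> of \<open>n\<close> in \<open>A\<close> would be smaller than \<open>n\<close>. As \<open>n\<close> is
  moved, some \<open>w \<in> B\<close> lies between \<open>u\<close> and \<open>n\<close>, so that the pairs \<open>u, n\<close> and \<open>w, n+1\<close> cross.
\<close>

lemma Min_moved_eq_imp_singleton:
  assumes nc: "noncrossing (block_rel \<pi>)" and n: "n \<in> A" "n + 1 \<in> B"
    and top: "\<And>v. v \<in> A \<Longrightarrow> v \<le> n + 1"
    and Min: "Min (moved m \<pi> (join_blocks \<pi> A B)) = n"
  shows "A = {n}"
proof (rule ccontr)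
  assume "A \<noteq> {n}"
  then obtain w0 where w0: "w0 \<in> A" "w0 \<noteq> n" using n(1) by blast
  have "n + 1 \<notin> A" using n(2) merged_blocks(7) by blast
  then have "w0 < n" using top[OF w0(1)] w0 by (metis Suc_eq_plus1 le_SucE le_neq_implies_less)
  obtain u where u: "u \<in> A" "n = cyclic_next A u" "cyclic_next (A \<union> B) u \<noteq> n"
  proof -
    have "n \<in> moved m \<pi> (join_blocks \<pi> A B)" using Min_moved_in Min by simp
    then obtain u where u: "u \<in> A \<and> n = cyclic_next A u \<or> u \<in> B \<and> n = cyclic_next B u"
      "cyclic_next (A \<union> B) u \<noteq> n" unfolding in_moved_iff by metis
    moreover have "n \<notin> B" using n(1) merged_blocks(7) by blast
    ultimately show ?thesis using that cyclic_next_in[OF merged_blocks(4)] by metis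
  qed
  have "u < n"
  proof (cases "\<exists>w\<in>A. u < w")
    case True
    then show ?thesis using cyclic_next_step(1)[OF merged_blocks(3)] u(2) by metis
  next
    case False
    then have "n = Min A" using u(2) by (simp add: cyclic_next_def)
    also have "\<dots> \<le> w0" using merged_blocks(3) w0(1) by simp
    finally show ?thesis using \<open>w0 < n\<close> by simp
  qed
  define w where "w = cyclic_next (A \<union> B) u"
  have fin: "finite (A \<union> B)" using merged_blocks(3,4) by simp
  have w: "u < w" "w < n" "w \<in> A \<union> B"
    using cyclic_next_step[OF fin _ \<open>u < n\<close>] cyclic_next_in[OF fin, of u] u n(1)
    by (auto simp: w_def order.strict_iff_order)
  have "w \<notin> A" using cyclic_next_step(2)[OF merged_blocks(3) _ w(1)] u(2) w(2) by (metis leD)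
  then have "(w, n + 1) \<in> block_rel \<pi>" using w(3) n(2) B unfolding block_rel_def by blast
  moreover have "(u, n) \<in> block_rel \<pi>" using u(1) n(1) A unfolding block_rel_def by blast
  ultimately have "(u, w) \<in> block_rel \<pi>"
    using nc w unfolding noncrossing_def by (metis less_add_one)
  then have "w \<in> block_of \<pi> u" by (simp add: block_of_def)
  then show False using block_of_eq[OF part A u(1)] \<open>w \<notin> A\<close> by simp
qed

end

lemma join_blocks_commute: "join_blocks \<pi> A B = join_blocks \<pi> B A"
  unfolding join_blocks_def by (simp add: Un_commute insert_commute)

text \<open>
  The moved numbers meet both merged blocks, so a minimum of \<open>n\<close> means that exactly \<open>n\<close> and \<open>n+1\<close>
  are moved, one from each block.
\<close>

lemma label_eq_penultimate_iff:
  assumes \<pi>: "\<pi> \<in> NC (n + 1)" and A: "A \<in> \<pi>" and B: "B \<in> \<pi>" and AB: "A \<noteq> B"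
  shows "Min (moved (n + 1) \<pi> (join_blocks \<pi> A B)) = n \<longleftrightarrow>
    {n} \<in> \<pi> \<and> (n, n + 1) \<in> block_rel (join_blocks \<pi> A B)"
proof -
  have part: "partition_on {1..n + 1} \<pi>" and nc: "noncrossing (block_rel \<pi>)"
    using \<pi> by (auto simp: NC_def)
  let ?M = "moved (n + 1) \<pi> (join_blocks \<pi> A B)"
  note blocks = merged_blocks[OF part A B AB]
  have BA: "B \<noteq> A" using AB by simp
  show ?thesis
  proof
    assume Min: "Min ?M = n"
    have ge: "v \<in> {n, n + 1}" if "v \<in> ?M" for v
      using Min_moved_le[OF part A B AB that] subsetD[OF moved_subset[OF part A B AB] that]
        blocks(1,2) Min by auto
    obtain a where a: "a \<in> ?M" "a \<in> A" using moved_meets[OF part A B AB] by blast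
    obtain b where b: "b \<in> ?M" "b \<in> B"
      using moved_meets[OF part B A BA] unfolding join_blocks_commute[of \<pi> B A] by blast
    have "a \<noteq> b" using a b blocks(7) by blast
    then consider "a = n" "b = n + 1" | "b = n" "a = n + 1" using ge[OF a(1)] ge[OF b(1)] by auto
    then have "A = {n} \<or> B = {n}"
    proof cases
      case 1
      then show ?thesis
        using Min_moved_eq_imp_singleton[OF part A B AB nc _ _ _ Min] a(2) b(2) blocks(1) by fastforce
    next
      case 2
      then show ?thesis
        using Min_moved_eq_imp_singleton[OF part B A BA nc _ _ _ Min[unfolded join_blocks_commute[of \<pi> A B]]]
          a(2) b(2) blocks(2) by fastforce
    qed
    moreover have "{n, n + 1} \<subseteq> A \<union> B" using \<open>a \<noteq> b\<close> a b ge[OF a(1)] ge[OF b(1)] by auto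
    ultimately show "{n} \<in> \<pi> \<and> (n, n + 1) \<in> block_rel (join_blocks \<pi> A B)"
      using A B unfolding block_rel_join_blocks[OF A B] by auto
  next
    assume *: "{n} \<in> \<pi> \<and> (n, n + 1) \<in> block_rel (join_blocks \<pi> A B)"
    have "(n, n + 1) \<notin> block_rel \<pi>"
    proof
      assume "(n, n + 1) \<in> block_rel \<pi>"
      then have "n + 1 \<in> block_of \<pi> n" by (simp add: block_of_def)
      then show False using block_of_eq[OF part, of "{n}" n] * by simp
    qed
    then have in_AB: "n \<in> A \<union> B" "n + 1 \<in> A \<union> B" using * unfolding block_rel_join_blocks[OF A B] by auto
    have single: "D = {n}" if "D \<in> \<pi>" "n \<in> D" for D
      using block_of_eq[OF part that] block_of_eq[OF part, of "{n}" n] * by simp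
    from in_AB(1) show "Min ?M = n"
    proof
      assume "n \<in> A"
      then have "A = {n}" using single A by blast
      then show ?thesis using Min_moved_singleton[OF part A B AB] in_AB(2) by auto
    next
      assume "n \<in> B"
      then have "B = {n}" using single B by blast
      then show ?thesis
        using Min_moved_singleton[OF part B A BA] in_AB(2) join_blocks_commute[of \<pi> A B] by auto
    qed
  qed
qed

section \<open>Labels of saturated chains\<close>

text \<open>
  The coverings of the lattice are the noncrossing merges of two blocks (\<open>exists_join_below\<close>), so these
  lists are its maximal chains.
\<close>

definition saturated_chain :: "nat \<Rightarrow> nat set set list \<Rightarrow> bool" where
  "saturated_chain m \<pi>s \<longleftrightarrow> \<pi>s \<noteq> [] \<and> hd \<pi>s = nc_min m \<and> last \<pi>s = nc_max m \<and> set \<pi>s \<subseteq> NC m \<and>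
     (\<forall>i. i + 1 < length \<pi>s \<longrightarrow>
        (\<exists>A\<in>\<pi>s ! i. \<exists>B\<in>\<pi>s ! i. A \<noteq> B \<and> \<pi>s ! (i + 1) = join_blocks (\<pi>s ! i) A B))"

definition blocks_meeting :: "nat set \<Rightarrow> nat set set \<Rightarrow> nat" where
  "blocks_meeting S \<pi> = (\<Sum>B\<in>\<pi>. of_bool (B \<inter> S \<noteq> {}))"

text \<open>
  Only a merge of two blocks that both meet \<open>S\<close> lowers the number of blocks meeting \<open>S\<close>.
\<close>

lemma blocks_meeting_join:
  assumes part: "partition_on {1..m} \<pi>" and A: "A \<in> \<pi>" and B: "B \<in> \<pi>" and AB: "A \<noteq> B"
  shows "blocks_meeting S (join_blocks \<pi> A B) + of_bool (A \<inter> S \<noteq> {} \<and> B \<inter> S \<noteq> {}) = blocks_meeting S \<pi>"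
proof -
  let ?h = "\<lambda>B. of_bool (B \<inter> S \<noteq> {}) :: nat"
  note blocks = merged_blocks[OF part A B AB]
  have fin: "finite \<pi>" using finite_elements[OF _ part] by simp
  have "A \<union> B \<notin> \<pi>"
  proof
    assume AB_in: "A \<union> B \<in> \<pi>"
    obtain a where a: "a \<in> A" using blocks(5) by blast
    then have "A \<union> B = A" using block_of_eq[OF part A a] block_of_eq[OF part AB_in, of a] by simp
    then show False using blocks(6,7) by blast
  qed
  then have "blocks_meeting S (join_blocks \<pi> A B) = ?h (A \<union> B) + sum ?h (\<pi> - {A, B})"
    unfolding blocks_meeting_def join_blocks_def using fin by (subst sum.insert) auto
  moreover have "blocks_meeting S \<pi> = ?h A + (?h B + sum ?h (\<pi> - {A, B}))"
  proof -
    have "blocks_meeting S \<pi> = ?h A + sum ?h (\<pi> - {A})"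
      unfolding blocks_meeting_def by (rule sum.remove[OF fin A])
    also have "sum ?h (\<pi> - {A}) = ?h B + sum ?h (\<pi> - {A} - {B})"
      using fin B AB by (intro sum.remove) auto
    also have "\<pi> - {A} - {B} = \<pi> - {A, B}" by blast
    finally show ?thesis .
  qed
  moreover have "?h (A \<union> B) + of_bool (A \<inter> S \<noteq> {} \<and> B \<inter> S \<noteq> {}) = ?h A + ?h B"
    by (auto simp: Int_Un_distrib2)
  ultimately show ?thesis by simp
qed

lemma blocks_meeting_nc_min: "S \<subseteq> {1..m} \<Longrightarrow> blocks_meeting S (nc_min m) = card S"
proof -
  assume S: "S \<subseteq> {1..m}"
  have "blocks_meeting S (nc_min m) = (\<Sum>v\<in>{1..m}. of_bool (v \<in> S))"
    unfolding blocks_meeting_def nc_min_def by (subst sum.reindex) auto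
  also have "\<dots> = card ({1..m} \<inter> S)"
    by (simp add: of_bool_def flip: sum.inter_restrict)
  also have "{1..m} \<inter> S = S" using S by blast
  finally show ?thesis .
qed

lemma blocks_meeting_nc_max: "S \<subseteq> {1..m} \<Longrightarrow> S \<noteq> {} \<Longrightarrow> blocks_meeting S (nc_max m) = 1"
  unfolding blocks_meeting_def nc_max_def by (auto simp: Int_absorb1)

lemma chain_label_eq:
  "chain_label m \<pi>s = map (\<lambda>i. Min (moved m (\<pi>s ! i) (\<pi>s ! (i + 1)))) [0..<length \<pi>s - 1]"
  unfolding chain_label_def moved_def ..

lemma set_chain_label:
  "set (chain_label m \<pi>s) = (\<lambda>i. Min (moved m (\<pi>s ! i) (\<pi>s ! (i + 1)))) ` {i. i + 1 < length \<pi>s}"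
proof -
  have "set [0..<length \<pi>s - 1] = {i. i + 1 < length \<pi>s}" by auto
  then show ?thesis unfolding chain_label_eq set_map by simp
qed

lemma saturated_chainE:
  assumes "saturated_chain m \<pi>s" "i + 1 < length \<pi>s"
  obtains A B where "\<pi>s ! i \<in> NC m" "\<pi>s ! (i + 1) \<in> NC m" "A \<in> \<pi>s ! i" "B \<in> \<pi>s ! i" "A \<noteq> B"
    "\<pi>s ! (i + 1) = join_blocks (\<pi>s ! i) A B"
proof -
  have "\<pi>s ! i \<in> set \<pi>s" "\<pi>s ! (i + 1) \<in> set \<pi>s" using assms(2) by auto
  then have "\<pi>s ! i \<in> NC m" "\<pi>s ! (i + 1) \<in> NC m"
    using assms(1) unfolding saturated_chain_def by blast+
  moreover obtain A B where "A \<in> \<pi>s ! i" "B \<in> \<pi>s ! i" "A \<noteq> B"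
    "\<pi>s ! (i + 1) = join_blocks (\<pi>s ! i) A B"
    using assms unfolding saturated_chain_def by blast
  ultimately show ?thesis using that by blast
qed

text \<open>
  The number of blocks meeting \<open>S\<close> drops from \<open>card S\<close> to \<open>1\<close>, by at most one in each step.
\<close>

lemma saturated_chain_telescope:
  assumes sat: "saturated_chain m \<pi>s" and S: "S \<subseteq> {1..m}" "S \<noteq> {}"
  shows "card {i. i < length \<pi>s - 1 \<and> blocks_meeting S (\<pi>s ! (i + 1)) < blocks_meeting S (\<pi>s ! i)} + 1 = card S"
proof -
  let ?b = "\<lambda>i. blocks_meeting S (\<pi>s ! i)"
  have step: "?b (i + 1) + of_bool (?b (i + 1) < ?b i) = ?b i" if "i < length \<pi>s - 1" for i
  proof -
    have "i + 1 < length \<pi>s" using that by simp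
    then obtain A B where AB: "\<pi>s ! i \<in> NC m" "A \<in> \<pi>s ! i" "B \<in> \<pi>s ! i" "A \<noteq> B"
      "\<pi>s ! (i + 1) = join_blocks (\<pi>s ! i) A B" by (rule saturated_chainE[OF sat])
    have "?b (i + 1) + of_bool (A \<inter> S \<noteq> {} \<and> B \<inter> S \<noteq> {}) = ?b i"
      unfolding AB(5) by (rule blocks_meeting_join[OF NC_partition[OF AB(1)] AB(2-4)])
    then show ?thesis by (cases "A \<inter> S \<noteq> {} \<and> B \<inter> S \<noteq> {}") (auto simp: of_bool_def)
  qed
  have "(\<Sum>i<j. of_bool (?b (i + 1) < ?b i)) + ?b j = ?b 0" if "j \<le> length \<pi>s - 1" for j
    using that
  proof (induction j)
    case (Suc j)
    then show ?case using step[of j] by simp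
  qed simp
  from this[of "length \<pi>s - 1"]
  have "(\<Sum>i<length \<pi>s - 1. of_bool (?b (i + 1) < ?b i)) + ?b (length \<pi>s - 1) = ?b 0" by simp
  moreover have "\<pi>s ! 0 = nc_min m" "\<pi>s ! (length \<pi>s - 1) = nc_max m"
    using sat unfolding saturated_chain_def by (metis hd_conv_nth, metis last_conv_nth)
  then have "?b 0 = card S" "?b (length \<pi>s - 1) = 1"
    using blocks_meeting_nc_min[OF S(1)] blocks_meeting_nc_max[OF S] by simp_all
  moreover have "(\<Sum>i<length \<pi>s - 1. of_bool (?b (i + 1) < ?b i) :: nat) =
      card {i. i < length \<pi>s - 1 \<and> ?b (i + 1) < ?b i}"
  proof -
    have "{..<length \<pi>s - 1} \<inter> {i. ?b (i + 1) < ?b i} = {i. i < length \<pi>s - 1 \<and> ?b (i + 1) < ?b i}"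
      by auto
    then show ?thesis by (simp only: sum_of_bool_eq finite_lessThan of_nat_id)
  qed
  ultimately show ?thesis by simp
qed

text \<open>For \<open>S = {1..m}\<close>, every step lowers the number of blocks.\<close>

lemma length_saturated_chain:
  assumes sat: "saturated_chain m \<pi>s" and m: "1 \<le> m"
  shows "length \<pi>s = m"
proof -
  let ?S = "{1..m}"
  have "blocks_meeting ?S (\<pi>s ! (i + 1)) < blocks_meeting ?S (\<pi>s ! i)" if "i < length \<pi>s - 1" for i
  proof -
    have "i + 1 < length \<pi>s" using that by simp
    then obtain A B where AB: "\<pi>s ! i \<in> NC m" "A \<in> \<pi>s ! i" "B \<in> \<pi>s ! i" "A \<noteq> B"
      "\<pi>s ! (i + 1) = join_blocks (\<pi>s ! i) A B" by (rule saturated_chainE[OF sat])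
    note part = NC_partition[OF AB(1)]
    have "A \<inter> ?S \<noteq> {} \<and> B \<inter> ?S \<noteq> {}" using merged_blocks[OF part AB(2-4)] by blast
    then show ?thesis using blocks_meeting_join[OF part AB(2-4), of ?S] AB(5) by simp
  qed
  then have "{i. i < length \<pi>s - 1 \<and> blocks_meeting ?S (\<pi>s ! (i + 1)) < blocks_meeting ?S (\<pi>s ! i)}
      = {..<length \<pi>s - 1}" by auto
  then have "length \<pi>s - 1 + 1 = m"
    using saturated_chain_telescope[OF sat, of ?S] m by simp
  moreover have "\<pi>s \<noteq> []" using sat by (simp add: saturated_chain_def)
  ultimately show ?thesis by (cases \<pi>s) auto
qed

text \<open>
  Equivalently, at least \<open>k\<close> entries are at most \<open>k\<close>, for every \<open>k\<close>.
\<close>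

lemma parking_functionI:
  assumes len: "length a = n" and pos: "\<And>x. x \<in> set a \<Longrightarrow> 0 < x"
    and few: "\<And>k. k \<le> n \<Longrightarrow> length (filter (\<lambda>x. k < x) a) \<le> n - k"
  shows "parking_function n a"
  unfolding parking_function_def
proof (intro conjI ballI allI impI)
  fix i assume i: "i < n"
  show "sort a ! i \<le> i + 1"
  proof (rule ccontr)
    assume gt: "\<not> sort a ! i \<le> i + 1"
    have "i + 1 < sort a ! j" if "i \<le> j" "j < n" for j
      using sorted_nth_mono[of "sort a" i j] that len gt by simp
    then have "{i..<n} \<subseteq> {j. j < length (sort a) \<and> i + 1 < sort a ! j}" using len by auto
    then have "card {i..<n} \<le> card {j. j < length (sort a) \<and> i + 1 < sort a ! j}"
      by (intro card_mono) auto
    also have "\<dots> = length (filter (\<lambda>x. i + 1 < x) (sort a))" by (simp add: length_filter_conv_card)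
    also have "\<dots> = length (filter (\<lambda>x. i + 1 < x) a)"
      by (metis mset_filter mset_sort size_mset)
    also have "\<dots> \<le> n - (i + 1)" using few i by simp
    finally show False using i by simp
  qed
qed (use len pos in auto)

text \<open>
  If the label of a step exceeds \<open>k\<close>, then all moved numbers lie in \<open>S = {k+1..n+1}\<close>. As both merged
  blocks contain moved numbers, the step lowers the number of blocks meeting \<open>S\<close>, which happens only
  \<open>card S - 1 = n - k\<close> times.
\<close>

lemma parking_function_chain_label:
  assumes sat: "saturated_chain (n + 1) \<pi>s"
  shows "parking_function n (chain_label (n + 1) \<pi>s)"
proof (rule parking_functionI)
  let ?M = "\<lambda>i. moved (n + 1) (\<pi>s ! i) (\<pi>s ! (i + 1))"
  have len: "length \<pi>s = n + 1" using length_saturated_chain[OF sat] by simp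
  then show "length (chain_label (n + 1) \<pi>s) = n" by (simp add: chain_label_eq)
  show "0 < x" if x: "x \<in> set (chain_label (n + 1) \<pi>s)" for x
  proof -
    obtain i where i: "i + 1 < length \<pi>s" "x = Min (?M i)" using x unfolding set_chain_label by blast
    obtain A B where AB: "\<pi>s ! i \<in> NC (n + 1)" "A \<in> \<pi>s ! i" "B \<in> \<pi>s ! i" "A \<noteq> B"
      "\<pi>s ! (i + 1) = join_blocks (\<pi>s ! i) A B" by (rule saturated_chainE[OF sat i(1)])
    note facts = NC_partition[OF AB(1)] AB(2-4)
    have "x \<in> A \<union> B" unfolding i(2) AB(5) using Min_moved_in[OF facts] moved_subset[OF facts] by blast
    then have "x \<in> {1..n + 1}" using merged_blocks(1,2)[OF facts] by blast
    then show "0 < x" by simp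
  qed
  show "length (filter (\<lambda>x. k < x) (chain_label (n + 1) \<pi>s)) \<le> n - k" if k: "k \<le> n" for k
  proof -
    let ?S = "{k + 1..n + 1}"
    have "{i. i < length \<pi>s - 1 \<and> k < Min (?M i)} \<subseteq>
      {i. i < length \<pi>s - 1 \<and> blocks_meeting ?S (\<pi>s ! (i + 1)) < blocks_meeting ?S (\<pi>s ! i)}"
    proof (rule subsetI, elim CollectE conjE, intro CollectI conjI)
      fix i assume i: "i < length \<pi>s - 1" and lt: "k < Min (?M i)"
      have "i + 1 < length \<pi>s" using i by simp
      then obtain A B where AB: "\<pi>s ! i \<in> NC (n + 1)" "A \<in> \<pi>s ! i" "B \<in> \<pi>s ! i" "A \<noteq> B"
        "\<pi>s ! (i + 1) = join_blocks (\<pi>s ! i) A B" by (rule saturated_chainE[OF sat])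
      note facts = NC_partition[OF AB(1)] AB(2-4)
      have BA: "B \<noteq> A" using AB(4) by simp
      have S: "v \<in> ?S" if "v \<in> ?M i" for v
      proof -
        have "v \<in> A \<union> B" using that moved_subset[OF facts] unfolding AB(5) by blast
        then have "v \<in> {1..n + 1}" using merged_blocks(1,2)[OF facts] by blast
        moreover have "k < v" using lt Min_moved_le[OF facts] that unfolding AB(5) by fastforce
        ultimately show ?thesis by simp
      qed
      obtain a b where "a \<in> A" "a \<in> ?M i" "b \<in> B" "b \<in> ?M i"
        using moved_meets[OF facts] moved_meets[OF facts(1,3,2) BA]
        unfolding AB(5) join_blocks_commute[of _ B A] by blast
      then have "A \<inter> ?S \<noteq> {} \<and> B \<inter> ?S \<noteq> {}" using S by blast
      then show "blocks_meeting ?S (\<pi>s ! (i + 1)) < blocks_meeting ?S (\<pi>s ! i)"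
        using blocks_meeting_join[OF facts, of ?S] AB(5) by simp
    qed auto
    then have "card {i. i < length \<pi>s - 1 \<and> k < Min (?M i)} \<le>
      card {i. i < length \<pi>s - 1 \<and> blocks_meeting ?S (\<pi>s ! (i + 1)) < blocks_meeting ?S (\<pi>s ! i)}"
      by (intro card_mono) auto
    also have "\<dots> \<le> n - k"
      using saturated_chain_telescope[OF sat, of ?S] k by auto
    also have "card {i. i < length \<pi>s - 1 \<and> k < Min (?M i)} =
        length (filter (\<lambda>x. k < x) (chain_label (n + 1) \<pi>s))"
    proof -
      have "{i. i < length \<pi>s - 1 \<and> k < Min (?M i)} =
          {i. i < length (chain_label (n + 1) \<pi>s) \<and> k < chain_label (n + 1) \<pi>s ! i}"
        by (auto simp: chain_label_eq)
      then show ?thesis by (simp add: length_filter_conv_card)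
    qed
    finally show ?thesis .
  qed
qed

lemma penultimate_in_chain_label_iff:
  assumes sat: "saturated_chain (n + 1) \<pi>s"
  shows "n \<in> set (chain_label (n + 1) \<pi>s) \<longleftrightarrow>
    (\<exists>i. i + 1 < length \<pi>s \<and> {n} \<in> \<pi>s ! i \<and> (n, n + 1) \<in> block_rel (\<pi>s ! (i + 1)))"
proof -
  have "Min (moved (n + 1) (\<pi>s ! i) (\<pi>s ! (i + 1))) = n \<longleftrightarrow>
      {n} \<in> \<pi>s ! i \<and> (n, n + 1) \<in> block_rel (\<pi>s ! (i + 1))" if i: "i + 1 < length \<pi>s" for i
  proof -
    obtain A B where AB: "\<pi>s ! i \<in> NC (n + 1)" "A \<in> \<pi>s ! i" "B \<in> \<pi>s ! i" "A \<noteq> B"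
      "\<pi>s ! (i + 1) = join_blocks (\<pi>s ! i) A B" by (rule saturated_chainE[OF sat i])
    show ?thesis unfolding AB(5) by (rule label_eq_penultimate_iff[OF AB(1-4)])
  qed
  moreover have "n \<in> set (chain_label (n + 1) \<pi>s) \<longleftrightarrow>
      (\<exists>i. i + 1 < length \<pi>s \<and> Min (moved (n + 1) (\<pi>s ! i) (\<pi>s ! (i + 1))) = n)"
    unfolding set_chain_label by (metis (mono_tags, lifting) image_iff mem_Collect_eq)
  ultimately show ?thesis by blast
qed

section \<open>Maximal simplices of the noncrossing partition link\<close>

text \<open>
  A pair \<open>u < v\<close> of minimal distance that is in one block of \<open>\<rho>\<close> but not of \<open>\<pi>\<close> consists of neighbours
  in a block of \<open>\<rho>\<close>.
\<close>

lemma exists_join_below: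
  assumes \<pi>: "\<pi> \<in> NC m" and \<rho>: "\<rho> \<in> NC m" and lt: "block_rel \<pi> \<subset> block_rel \<rho>"
  obtains A B where "A \<in> \<pi>" "B \<in> \<pi>" "A \<noteq> B" "join_blocks \<pi> A B \<in> NC m"
    "block_rel (join_blocks \<pi> A B) \<subseteq> block_rel \<rho>" "block_rel \<pi> \<subset> block_rel (join_blocks \<pi> A B)"
proof -
  note part = NC_partition[OF \<pi>]
  note tr = block_rel_trans[OF part]
  let ?P = "\<lambda>d. \<exists>u. (u, u + d) \<in> block_rel \<rho> - block_rel \<pi>"
  have ex: "\<exists>d. ?P d"
  proof -
    obtain u v where uv: "(u, v) \<in> block_rel \<rho>" "(u, v) \<notin> block_rel \<pi>" using lt by auto
    then have "(v, u) \<in> block_rel \<rho>" "(v, u) \<notin> block_rel \<pi>" using block_rel_sym by fast+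
    with uv show ?thesis by (cases "u \<le> v") (metis DiffI le_add_diff_inverse nat_le_linear)+
  qed
  define d where "d = (LEAST d. ?P d)"
  obtain u where u: "(u, u + d) \<in> block_rel \<rho>" "(u, u + d) \<notin> block_rel \<pi>"
    using LeastI_ex[OF ex] unfolding d_def by blast
  have least: "(v, v + e) \<in> block_rel \<pi>" if "e < d" "(v, v + e) \<in> block_rel \<rho>" for v e
    using not_less_Least[of e ?P] that unfolding d_def by blast
  have in_m: "u \<in> {1..m}" "u + d \<in> {1..m}" using block_rel_in[OF NC_partition[OF \<rho>] u(1)] by auto
  have "d \<noteq> 0" using u(2) block_rel_refl[OF part in_m(1)] by (intro notI) simp
  have gap: "(u, w) \<notin> block_rel \<rho>" if "u < w" "w < u + d" for w
  proof
    assume uw: "(u, w) \<in> block_rel \<rho>"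
    then have wv: "(w, u + d) \<in> block_rel \<rho>"
      using block_rel_trans[OF NC_partition[OF \<rho>] block_rel_sym u(1)] by blast
    have "(u, w) \<in> block_rel \<pi>" using least[of "w - u" u] uw that by simp
    moreover have "(w, u + d) \<in> block_rel \<pi>" using least[of "u + d - w" w] wv that by simp
    ultimately show False using u(2) tr by blast
  qed
  let ?A = "block_of \<pi> u" and ?B = "block_of \<pi> (u + d)"
  have AB: "?A \<in> \<pi>" "?B \<in> \<pi>" using block_of_in[OF part] in_m by auto
  have self: "u \<in> ?A" "u + d \<in> ?B" using block_of_self[OF part] in_m by auto
  have "u + d \<notin> ?A" using u(2) by (simp add: block_of_def)
  then have "?A \<noteq> ?B" using self by blast
  moreover have "block_rel \<pi> \<subset> block_rel (join_blocks \<pi> ?A ?B)"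
    unfolding block_rel_join_blocks[OF AB] using u(2) self by blast
  moreover have "join_blocks \<pi> ?A ?B \<in> NC m" "block_rel (join_blocks \<pi> ?A ?B) \<subseteq> block_rel \<rho>"
    using join_neighbours[OF \<pi> \<rho> _ _ u(1) gap] lt \<open>d \<noteq> 0\<close> by auto
  ultimately show ?thesis using that[OF AB] by blast
qed

lemma strictly_refines_iff:
  assumes "\<pi> \<in> NC m" "\<rho> \<in> NC m"
  shows "strictly_refines m \<pi> \<rho> \<longleftrightarrow> block_rel \<pi> \<subset> block_rel \<rho>"
  using refines_iff_block_rel[OF NC_partition[OF assms(1)] NC_partition[OF assms(2)]]
    inj_onD[OF inj_on_block_rel _ assms]
  unfolding strictly_refines_def by auto

definition nc_chain :: "nat \<Rightarrow> nat set set set \<Rightarrow> bool" where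
  "nc_chain m C \<longleftrightarrow> C \<subseteq> NC m \<and> (\<forall>x\<in>C. \<forall>y\<in>C. block_rel x \<subseteq> block_rel y \<or> block_rel y \<subseteq> block_rel x)"

lemma nc_link_eq:
  assumes "noncrossing_partitions m p = NC m"
  shows "nc_link m p = {\<sigma>. \<sigma> \<noteq> {} \<and> \<sigma> \<subseteq> NC m - {nc_min m, nc_max m} \<and> nc_chain m \<sigma>}"
proof -
  have "finite \<sigma> \<and> \<sigma> \<noteq> {} \<and> pred_on.chain (NC m - {nc_min m, nc_max m}) (strictly_refines m) \<sigma> \<longleftrightarrow>
      \<sigma> \<noteq> {} \<and> \<sigma> \<subseteq> NC m - {nc_min m, nc_max m} \<and> nc_chain m \<sigma>" for \<sigma>
  proof (cases "\<sigma> \<subseteq> NC m - {nc_min m, nc_max m}")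
    case True
    then have sub: "\<sigma> \<subseteq> NC m" by blast
    have "sup (strictly_refines m) (=) x y \<longleftrightarrow> block_rel x \<subseteq> block_rel y" if "x \<in> \<sigma>" "y \<in> \<sigma>" for x y
    proof -
      have "x \<in> NC m" "y \<in> NC m" using that sub by auto
      then show ?thesis
        using strictly_refines_iff[of x m y] inj_on_eq_iff[OF inj_on_block_rel, of x m y] by auto
    qed
    then show ?thesis
      using True sub finite_subset[OF sub finite_NC] unfolding pred_on.chain_def nc_chain_def by simp
  qed (simp add: pred_on.chain_def)
  then show ?thesis unfolding nc_link_def order_complex_def assms by blast
qed

text \<open>
  The number of related pairs is strictly increasing along a chain, so sorting by it is the only way to
  list the chain in increasing order.
\<close>

lemma ex1_sorted_nc_chain:
  assumes C: "nc_chain m C"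
  shows "\<exists>!\<pi>s. sorted_wrt (strictly_refines m) \<pi>s \<and> set \<pi>s = C"
proof -
  let ?g = "\<lambda>x. card (block_rel x)"
  have CN: "C \<subseteq> NC m" using C by (simp add: nc_chain_def)
  have finC: "finite C" using finite_subset[OF CN finite_NC] .
  have fin: "finite (block_rel x)" if "x \<in> C" for x
    using finite_subset[OF block_rel_le_nc_max] that CN by (auto simp: block_rel_nc_max)
  have lt: "strictly_refines m x y \<longleftrightarrow> ?g x < ?g y" if xy: "x \<in> C" "y \<in> C" for x y
  proof -
    have "block_rel x \<subseteq> block_rel y \<or> block_rel y \<subseteq> block_rel x" using C xy by (simp add: nc_chain_def)
    then have "block_rel x \<subset> block_rel y \<longleftrightarrow> ?g x < ?g y"
      using psubset_card_mono[OF fin[OF xy(2)], of "block_rel x"]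
        card_mono[OF fin[OF xy(1)], of "block_rel y"]
      by (cases "block_rel x \<subset> block_rel y") auto
    then show ?thesis using strictly_refines_iff xy CN by blast
  qed
  have inj: "inj_on ?g C"
  proof (rule inj_onI)
    fix x y assume xy: "x \<in> C" "y \<in> C" "?g x = ?g y"
    have "block_rel x \<subseteq> block_rel y \<or> block_rel y \<subseteq> block_rel x" using C xy by (simp add: nc_chain_def)
    then have "block_rel x = block_rel y" using card_subset_eq fin xy by metis
    then show "x = y" using inj_onD[OF inj_on_block_rel] xy CN by blast
  qed
  have sorted_iff: "sorted_wrt (strictly_refines m) \<pi>s \<longleftrightarrow> sorted_wrt (<) (map ?g \<pi>s)" if "set \<pi>s = C" for \<pi>s
  proof -
    have "\<pi>s ! i \<in> C" if "i < length \<pi>s" for i using nth_mem[OF that] \<open>set \<pi>s = C\<close> by simp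
    then have "strictly_refines m (\<pi>s ! i) (\<pi>s ! j) \<longleftrightarrow> ?g (\<pi>s ! i) < ?g (\<pi>s ! j)"
      if "i < j" "j < length \<pi>s" for i j
      using lt that by simp
    then show ?thesis unfolding sorted_wrt_map sorted_wrt_iff_nth_less by simp
  qed
  define \<pi>s where "\<pi>s = map (inv_into C ?g) (sorted_list_of_set (?g ` C))"
  have g\<pi>s: "map ?g \<pi>s = sorted_list_of_set (?g ` C)"
    unfolding \<pi>s_def map_map o_def using finC by (intro map_idI f_inv_into_f[where f = ?g and A = C]) simp
  have "set \<pi>s = C" unfolding \<pi>s_def using inj finC by (simp add: inv_into_image_cancel)
  moreover from this have "sorted_wrt (strictly_refines m) \<pi>s"
    unfolding sorted_iff[OF \<open>set \<pi>s = C\<close>] g\<pi>s by simp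
  moreover have "\<rho>s = \<pi>s" if \<rho>s: "sorted_wrt (strictly_refines m) \<rho>s" "set \<rho>s = C" for \<rho>s
  proof -
    have "map ?g \<rho>s = sorted_list_of_set (?g ` C)"
      using \<rho>s finC sorted_iff[OF \<rho>s(2)]
      by (intro strict_sorted_equal) auto
    then have "map ?g \<rho>s = map ?g \<pi>s" using g\<pi>s by simp
    then show ?thesis using inj \<rho>s(2) \<open>set \<pi>s = C\<close> by (intro map_inj_on[of ?g]) auto
  qed
  ultimately show ?thesis by blast
qed

lemma nc_chain_bounds:
  assumes "nc_chain m \<sigma>" "1 \<le> m"
  shows "nc_chain m ({nc_min m, nc_max m} \<union> \<sigma>)"
  using assms nc_min_in_NC[of m] nc_max_in_NC[of m] block_rel_nc_min_le[of _ m] block_rel_le_nc_max[of _ m]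
  unfolding nc_chain_def by (simp add: subset_iff) blast

text \<open>
  If a step were not a single merge, an intermediate partition could be inserted, contrary to the
  maximality of the simplex.
\<close>

lemma simplex_chain_saturated:
  assumes NC: "noncrossing_partitions m p = NC m" and m: "2 \<le> m" and \<tau>: "\<tau> \<in> maximal_simplices (nc_link m p)"
  shows "saturated_chain m (simplex_chain m \<tau>)" (is ?sat)
    and "set (simplex_chain m \<tau>) = {nc_min m, nc_max m} \<union> \<tau>" (is ?set)
    and "\<And>i j. i < j \<Longrightarrow> j < length (simplex_chain m \<tau>) \<Longrightarrow>
      block_rel (simplex_chain m \<tau> ! i) \<subset> block_rel (simplex_chain m \<tau> ! j)" (is "PROP ?mono")
proof -
  let ?C = "{nc_min m, nc_max m} \<union> \<tau>"
  define \<pi>s where "\<pi>s = simplex_chain m \<tau>"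
  note link = nc_link_eq[OF NC]
  have \<tau>L: "\<tau> \<in> nc_link m p" and max: "\<And>\<rho>. \<rho> \<in> nc_link m p \<Longrightarrow> \<tau> \<subseteq> \<rho> \<Longrightarrow> \<rho> = \<tau>"
    using \<tau> by (auto simp: maximal_simplices_def)
  have chain: "nc_chain m \<tau>" and \<tau>sub: "\<tau> \<subseteq> NC m - {nc_min m, nc_max m}" using \<tau>L by (auto simp: link)
  have C: "nc_chain m ?C" using nc_chain_bounds[OF chain] m by simp
  have ordered: "sorted_wrt (strictly_refines m) \<pi>s \<and> set \<pi>s = ?C"
    unfolding \<pi>s_def simplex_chain_def by (rule theI'[OF ex1_sorted_nc_chain[OF C]])
  note sorted = conjunct1[OF ordered] and set = conjunct2[OF ordered]
  have CN: "?C \<subseteq> NC m" using C by (simp add: nc_chain_def)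
  have inN: "\<pi>s ! i \<in> NC m" if "i < length \<pi>s" for i
    using subsetD[OF CN nth_mem[OF that, unfolded set]] .
  have mono: "block_rel (\<pi>s ! i) \<subset> block_rel (\<pi>s ! j)" if "i < j" "j < length \<pi>s" for i j
    using sorted_wrt_nth_less[OF sorted that] strictly_refines_iff inN that by simp
  then show "PROP ?mono" unfolding \<pi>s_def .
  show ?set using set unfolding \<pi>s_def .
  have ne: "\<pi>s \<noteq> []" using set by auto
  have first: "\<pi>s ! 0 = nc_min m"
  proof -
    obtain j where j: "j < length \<pi>s" "\<pi>s ! j = nc_min m" using set by (metis UnI1 insertI1 in_set_conv_nth)
    then show ?thesis using mono[of 0 j] block_rel_nc_min_le[OF inN[of 0]] ne by (cases "j = 0") auto
  qed
  have last: "\<pi>s ! (length \<pi>s - 1) = nc_max m"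
  proof -
    obtain j where j: "j < length \<pi>s" "\<pi>s ! j = nc_max m"
      using set by (metis UnI1 insertI1 insertI2 in_set_conv_nth)
    have "\<not> j < length \<pi>s - 1"
      using mono[of j "length \<pi>s - 1"] block_rel_le_nc_max[OF inN[of "length \<pi>s - 1"]] j(2) ne
      by auto
    then have "j = length \<pi>s - 1" using j(1) by linarith
    then show ?thesis using j(2) by simp
  qed
  have step: "\<exists>A\<in>\<pi>s ! i. \<exists>B\<in>\<pi>s ! i. A \<noteq> B \<and> \<pi>s ! (i + 1) = join_blocks (\<pi>s ! i) A B"
    if i: "i + 1 < length \<pi>s" for i
  proof -
    let ?x = "\<pi>s ! i" and ?y = "\<pi>s ! (i + 1)"
    have xy: "?x \<in> NC m" "?y \<in> NC m" "block_rel ?x \<subset> block_rel ?y" using inN mono i by auto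
    obtain A B where AB: "A \<in> ?x" "B \<in> ?x" "A \<noteq> B" and z: "join_blocks ?x A B \<in> NC m"
      "block_rel (join_blocks ?x A B) \<subseteq> block_rel ?y" "block_rel ?x \<subset> block_rel (join_blocks ?x A B)"
      by (rule exists_join_below[OF xy])
    define z where "z = join_blocks ?x A B"
    note z = z[folded z_def]
    have le: "block_rel (\<pi>s ! j) \<subseteq> block_rel ?x" if "j \<le> i" for j
      using mono[of j i] that i by (cases "j = i") auto
    have ge: "block_rel ?y \<subseteq> block_rel (\<pi>s ! j)" if "i < j" "j < length \<pi>s" for j
      using mono[of "i + 1" j] that by (cases "j = i + 1") auto
    have cmp: "block_rel w \<subset> block_rel z \<or> block_rel ?y \<subseteq> block_rel w" if "w \<in> ?C" for w
    proof -
      obtain j where j: "j < length \<pi>s" "w = \<pi>s ! j"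
        using \<open>w \<in> ?C\<close>[folded set] by (metis in_set_conv_nth)
      show ?thesis
      proof (cases "j \<le> i")
        case True
        then show ?thesis using subset_psubset_trans[OF le z(3)] j(2) by simp
      next
        case False
        then show ?thesis using ge[of j] j by simp
      qed
    qed
    have "block_rel z = block_rel ?y"
    proof (rule ccontr)
      assume "block_rel z \<noteq> block_rel ?y"
      then have zy: "block_rel z \<subset> block_rel ?y" using z(2) by blast
      then have z_notin: "z \<notin> ?C" using cmp[of z] by blast
      have cmp': "block_rel w \<subseteq> block_rel z \<or> block_rel z \<subseteq> block_rel w" if "w \<in> \<tau>" for w
        using cmp[of w] that zy by blast
      have "\<forall>u\<in>insert z \<tau>. \<forall>v\<in>insert z \<tau>. block_rel u \<subseteq> block_rel v \<or> block_rel v \<subseteq> block_rel u"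
        using cmp' chain unfolding nc_chain_def by auto
      then have "insert z \<tau> \<in> nc_link m p"
        using \<tau>sub z(1) z_notin unfolding link nc_chain_def by auto
      then have "insert z \<tau> = \<tau>" using max by blast
      then show False using z_notin by blast
    qed
    then have "z = ?y" using inj_onD[OF inj_on_block_rel _ z(1) xy(2)] by simp
    then show ?thesis using AB unfolding z_def by metis
  qed
  show ?sat
    unfolding saturated_chain_def \<pi>s_def[symmetric]
    using ne first last step set CN by (simp add: hd_conv_nth last_conv_nth)
qed

lemma in_detours_iff:
  assumes x: "x \<in> NC (n + 1)" and n: "1 \<le> n"
  shows "x \<in> detours n \<longleftrightarrow> {n} \<notin> x \<and> (n, n + 1) \<notin> block_rel x"
proof -
  note part = NC_partition[OF x]
  have n_in: "n \<in> {1..n + 1}" using n by simp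
  have "(\<exists>w<n. (w, n) \<in> block_rel x) \<longleftrightarrow> {n} \<notin> x" if *: "(n, n + 1) \<notin> block_rel x"
  proof
    assume "\<exists>w<n. (w, n) \<in> block_rel x"
    then obtain w where w: "w < n" "(w, n) \<in> block_rel x" by blast
    then have "w \<in> block_of x n" using block_rel_sym[OF w(2)] by (simp add: block_of_def)
    with w(1) show "{n} \<notin> x" using block_of_eq[OF part, of "{n}" n] by auto
  next
    assume "{n} \<notin> x"
    then have "block_of x n \<noteq> {n}" using block_of_in[OF part n_in] by auto
    then obtain w where w: "w \<in> block_of x n" "w \<noteq> n" using block_of_self[OF part n_in] by blast
    then have nw: "(n, w) \<in> block_rel x" by (simp add: block_of_def)
    then have "w \<noteq> n + 1" "w \<le> n + 1" using * block_rel_in[OF part nw] by auto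
    then have "w < n" using w(2) by linarith
    then show "\<exists>w<n. (w, n) \<in> block_rel x" using block_rel_sym[OF nw] by blast
  qed
  then show ?thesis using x unfolding detours_def by blast
qed

lemma below_nc_max: "1 \<le> m \<Longrightarrow> below m (nc_max m) = NC m - {nc_min m, nc_max m}"
  using block_rel_le_nc_max inj_onD[OF inj_on_block_rel _ _ nc_max_in_NC]
  unfolding below_def by blast

text \<open>
  The kind of a partition can only change upwards along a maximal chain: first \<open>{n}\<close> is a block, then
  possibly come detours, and finally \<open>n\<close> and \<open>n+1\<close> share a block. So either the chain contains a detour,
  or there is a step from the first kind to the last, and that step has the label \<open>n\<close>. Conversely, any
  chain in the star of a detour extends to a maximal one that contains the detour.
\<close>

theorem avoiding_complex_eq_star_union:
  assumes NC: "noncrossing_partitions (n + 1) p = NC (n + 1)" and n: "2 \<le> n"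
  shows "with_faces {\<sigma> \<in> maximal_simplices (nc_link (n + 1) p).
               parking_function n (simplex_label (n + 1) \<sigma>) \<and>
               (\<forall>a \<in> set (simplex_label (n + 1) \<sigma>). a \<noteq> n)} =
    star_union block_rel (below (n + 1) (nc_max (n + 1))) (detours n \<inter> below (n + 1) (nc_max (n + 1)))"
    (is "with_faces ?F = star_union _ ?V ?Z")
proof -
  let ?m = "n + 1"
  note link = nc_link_eq[OF NC]
  have V: "?V = NC ?m - {nc_min ?m, nc_max ?m}" by (rule below_nc_max) simp
  have max_n: "(n, n + 1) \<in> block_rel (nc_max ?m)" using n by (simp add: block_rel_nc_max)
  have iff: "\<tau> \<in> ?F \<longleftrightarrow> (\<exists>z\<in>\<tau>. z \<in> detours n)" if \<tau>: "\<tau> \<in> maximal_simplices (nc_link ?m p)" for \<tau>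
  proof -
    let ?\<pi>s = "simplex_chain ?m \<tau>"
    have m2: "2 \<le> ?m" using n by simp
    note facts = simplex_chain_saturated[OF NC m2 \<tau>]
    have ends: "?\<pi>s \<noteq> []" "?\<pi>s ! 0 = nc_min ?m" "?\<pi>s ! (length ?\<pi>s - 1) = nc_max ?m"
      using facts(1) hd_conv_nth[of ?\<pi>s] last_conv_nth[of ?\<pi>s] by (auto simp: saturated_chain_def)
    have inN: "?\<pi>s ! i \<in> NC ?m" if "i < length ?\<pi>s" for i
      using facts(1) nth_mem[OF that] unfolding saturated_chain_def by blast
    have mono: "block_rel (?\<pi>s ! i) \<subseteq> block_rel (?\<pi>s ! j)" if "i \<le> j" "j < length ?\<pi>s" for i j
      using facts(3)[of i j] that by (cases "i = j") auto
    have "\<tau> \<in> ?F \<longleftrightarrow> n \<notin> set (chain_label ?m ?\<pi>s)"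
      using \<tau> parking_function_chain_label[OF facts(1)] unfolding simplex_label_def by blast
    also have "\<dots> \<longleftrightarrow> \<not> (\<exists>i. i + 1 < length ?\<pi>s \<and> {n} \<in> ?\<pi>s ! i \<and> (n, n + 1) \<in> block_rel (?\<pi>s ! (i + 1)))"
      unfolding penultimate_in_chain_label_iff[OF facts(1)] ..
    also have "\<dots> \<longleftrightarrow> (\<exists>z\<in>\<tau>. z \<in> detours n)"
    proof
      assume no: "\<not> (\<exists>i. i + 1 < length ?\<pi>s \<and> {n} \<in> ?\<pi>s ! i \<and> (n, n + 1) \<in> block_rel (?\<pi>s ! (i + 1)))"
      (* The first entry in which n is not a singleton must be a detour. *)
      let ?Q = "\<lambda>j. j < length ?\<pi>s \<and> {n} \<notin> ?\<pi>s ! j"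
      have "n + 1 \<in> {1..?m}" "n + 1 \<notin> {n}" by auto
      then have "{n} \<notin> nc_max ?m" unfolding nc_max_def by (metis singletonD)
      then have exQ: "\<exists>j. ?Q j" using ends(1,3) by (intro exI[of _ "length ?\<pi>s - 1"]) simp
      define j where "j = (LEAST j. ?Q j)"
      have j: "?Q j" unfolding j_def by (rule LeastI_ex[OF exQ])
      have "{n} \<in> ?\<pi>s ! 0" using ends(2) n by (simp add: nc_min_def)
      then obtain i where i: "j = i + 1" using j by (cases j) auto
      have "{n} \<in> ?\<pi>s ! i" using not_less_Least[of i ?Q] i j unfolding j_def[symmetric] by simp
      then have "(n, n + 1) \<notin> block_rel (?\<pi>s ! j)" using no i j by blast
      then have det: "?\<pi>s ! j \<in> detours n" using in_detours_iff[OF inN] j n by simp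
      have "?\<pi>s ! j \<noteq> nc_max ?m" using \<open>(n, n + 1) \<notin> block_rel (?\<pi>s ! j)\<close> max_n by auto
      moreover have "?\<pi>s ! j \<noteq> nc_min ?m" using j n by (auto simp: nc_min_def)
      moreover have "?\<pi>s ! j \<in> {nc_min ?m, nc_max ?m} \<union> \<tau>"
        using nth_mem[of j ?\<pi>s, unfolded facts(2)] j by blast
      ultimately show "\<exists>z\<in>\<tau>. z \<in> detours n" using det by blast
    next
      assume "\<exists>z\<in>\<tau>. z \<in> detours n"
      then obtain z where z: "z \<in> \<tau>" "z \<in> detours n" by blast
      then obtain j where j: "j < length ?\<pi>s" "z = ?\<pi>s ! j" using facts(2) by (metis UnI2 in_set_conv_nth)
      have zz: "{n} \<notin> z" "(n, n + 1) \<notin> block_rel z" using in_detours_iff[OF inN[OF j(1)]] z(2) j(2) n by auto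
      show "\<not> (\<exists>i. i + 1 < length ?\<pi>s \<and> {n} \<in> ?\<pi>s ! i \<and> (n, n + 1) \<in> block_rel (?\<pi>s ! (i + 1)))"
      proof (intro notI, elim exE conjE)
        fix i assume i: "i + 1 < length ?\<pi>s" "{n} \<in> ?\<pi>s ! i" "(n, n + 1) \<in> block_rel (?\<pi>s ! (i + 1))"
        show False
        proof (cases "j \<le> i")
          case False
          then show False using mono[of "i + 1" j] j i(3) zz(2) by auto
        next
          case True
          then have "block_rel z \<subseteq> block_rel (?\<pi>s ! i)" using mono[of j i] i(1) j(2) by simp
          moreover obtain w where w: "w < n" "(w, n) \<in> block_rel z" using z(2) by (auto simp: detours_def)
          ultimately have "(w, n) \<in> block_rel (?\<pi>s ! i)" by blast
          then have w_in: "w \<in> block_of (?\<pi>s ! i) n" unfolding block_of_def by (simp add: block_rel_sym)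
          have "block_of (?\<pi>s ! i) n = {n}"
            using block_of_eq[OF NC_partition[OF inN] i(2)] i(1) by simp
          then show False using w(1) w_in by simp
        qed
      qed
    qed
    finally show ?thesis .
  qed
  show ?thesis
  proof
    show "with_faces ?F \<subseteq> star_union block_rel ?V ?Z"
    proof
      fix \<sigma> assume "\<sigma> \<in> with_faces ?F"
      then obtain \<tau> where \<sigma>: "\<sigma> \<noteq> {}" "\<sigma> \<subseteq> \<tau>" and \<tau>: "\<tau> \<in> ?F" unfolding with_faces_def by blast
      have \<tau>max: "\<tau> \<in> maximal_simplices (nc_link ?m p)" using \<tau> by blast
      then obtain z where z: "z \<in> \<tau>" "z \<in> detours n" using iff \<tau> by blast
      have "\<tau> \<in> nc_link ?m p" using \<tau>max by (simp add: maximal_simplices_def)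
      then have "\<tau> \<subseteq> ?V" "nc_chain ?m \<tau>" unfolding link V by auto
      then have chain: "\<forall>x\<in>\<tau>. \<forall>y\<in>\<tau>. block_rel x \<subseteq> block_rel y \<or> block_rel y \<subseteq> block_rel x"
        by (simp add: nc_chain_def)
      show "\<sigma> \<in> star_union block_rel ?V ?Z"
        unfolding star_union_def
      proof (intro CollectI conjI)
        show "\<sigma> \<noteq> {}" by (fact \<sigma>(1))
        show "\<sigma> \<subseteq> ?V" using \<sigma>(2) \<open>\<tau> \<subseteq> ?V\<close> by blast
        show "\<forall>x\<in>\<sigma>. \<forall>y\<in>\<sigma>. block_rel x \<subseteq> block_rel y \<or> block_rel y \<subseteq> block_rel x"
          using chain \<sigma>(2) by (meson subsetD)
        show "\<exists>z\<in>?Z. \<forall>x\<in>\<sigma>. block_rel x \<subseteq> block_rel z \<or> block_rel z \<subseteq> block_rel x"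
        proof (rule bexI[of _ z])
          show "\<forall>x\<in>\<sigma>. block_rel x \<subseteq> block_rel z \<or> block_rel z \<subseteq> block_rel x"
            using chain \<sigma>(2) z(1) by (meson subsetD)
          show "z \<in> ?Z" using z \<open>\<tau> \<subseteq> ?V\<close> by blast
        qed
      qed
    qed
    show "star_union block_rel ?V ?Z \<subseteq> with_faces ?F"
    proof
      fix \<sigma> assume "\<sigma> \<in> star_union block_rel ?V ?Z"
      then obtain z where \<sigma>: "\<sigma> \<noteq> {}" "\<sigma> \<subseteq> ?V"
          "\<forall>x\<in>\<sigma>. \<forall>y\<in>\<sigma>. block_rel x \<subseteq> block_rel y \<or> block_rel y \<subseteq> block_rel x"
        and z: "z \<in> ?Z" "\<forall>x\<in>\<sigma>. block_rel x \<subseteq> block_rel z \<or> block_rel z \<subseteq> block_rel x"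
        unfolding star_union_def by auto
      have sub: "insert z \<sigma> \<subseteq> ?V" using \<sigma>(2) z(1) by blast
      have cmp: "\<forall>x\<in>insert z \<sigma>. \<forall>y\<in>insert z \<sigma>. block_rel x \<subseteq> block_rel y \<or> block_rel y \<subseteq> block_rel x"
        using \<sigma>(3) z(2) by auto
      have "insert z \<sigma> \<subseteq> NC ?m" using sub V by blast
      then have ins: "insert z \<sigma> \<in> nc_link ?m p"
        using sub cmp unfolding link V nc_chain_def by simp
      have "nc_link ?m p \<subseteq> Pow (NC ?m)" unfolding link by blast
      then have "finite (nc_link ?m p)" using finite_subset finite_NC by blast
      then obtain \<tau> where \<tau>: "\<tau> \<in> nc_link ?m p" "insert z \<sigma> \<subseteq> \<tau>"
          "\<forall>\<rho>\<in>nc_link ?m p. \<tau> \<subseteq> \<rho> \<longrightarrow> \<tau> = \<rho>"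
        using finite_has_maximal2[OF _ ins] by blast
      then have \<tau>max: "\<tau> \<in> maximal_simplices (nc_link ?m p)" unfolding maximal_simplices_def by blast
      have "z \<in> \<tau>" "z \<in> detours n" using \<tau>(2) z(1) by auto
      then have "\<tau> \<in> ?F" using iff[OF \<tau>max] by blast
      then show "\<sigma> \<in> with_faces ?F" using \<sigma>(1) \<tau>(2) unfolding with_faces_def by blast
    qed
  qed
qed

theorem theorem2:
  fixes n :: nat and p :: "nat \<Rightarrow> complex" and K :: "nat set set set set"
  assumes "n \<ge> 2"
    and "clockwise_convex_polygon (n + 1) p"
    and "K = with_faces {\<sigma> \<in> maximal_simplices (nc_link (n + 1) p).
               parking_function n (simplex_label (n + 1) \<sigma>) \<and>
               (\<forall>a \<in> set (simplex_label (n + 1) \<sigma>). a \<noteq> n)}"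
  shows "subcomplex K (nc_link (n + 1) p) \<and> contractible_complex K"
proof -
  let ?m = "n + 1"
  have NC: "noncrossing_partitions ?m p = NC ?m"
    using assms(1) by (intro noncrossing_partitions_eq_NC[OF assms(2)]) simp
  note link = nc_link_eq[OF NC]
  have link_complex: "abstract_simplicial_complex (nc_link ?m p)"
    unfolding abstract_simplicial_complex_def
  proof (intro conjI ballI allI impI)
    fix \<sigma> assume \<sigma>: "\<sigma> \<in> nc_link ?m p"
    then have "\<sigma> \<subseteq> NC ?m" unfolding link by blast
    then show "finite \<sigma>" using finite_subset finite_NC by blast
    show "\<sigma> \<noteq> {}" using \<sigma> unfolding link by blast
    fix \<rho> assume "\<rho> \<noteq> {} \<and> \<rho> \<subseteq> \<sigma>"
    then show "\<rho> \<in> nc_link ?m p" using \<sigma> unfolding link nc_chain_def by (simp add: subset_iff)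
  qed
  have sub: "K \<subseteq> nc_link ?m p"
  proof
    fix \<rho> assume "\<rho> \<in> K"
    then obtain \<sigma> where "\<sigma> \<in> nc_link ?m p" "\<rho> \<noteq> {} \<and> \<rho> \<subseteq> \<sigma>"
      unfolding assms(3) with_faces_def maximal_simplices_def by blast
    then show "\<rho> \<in> nc_link ?m p" using link_complex unfolding abstract_simplicial_complex_def by blast
  qed
  have K_complex: "abstract_simplicial_complex K"
    unfolding abstract_simplicial_complex_def
  proof (intro conjI ballI allI impI)
    fix \<sigma> assume \<sigma>: "\<sigma> \<in> K"
    then have "\<sigma> \<in> nc_link ?m p" using sub by blast
    then show "finite \<sigma>" "\<sigma> \<noteq> {}" using link_complex unfolding abstract_simplicial_complex_def by blast+
    fix \<rho> assume "\<rho> \<noteq> {} \<and> \<rho> \<subseteq> \<sigma>"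
    then show "\<rho> \<in> K" using \<sigma> unfolding assms(3) with_faces_def by blast
  qed
  have "collapsible (star_union block_rel (below ?m (nc_max ?m)) (detours n \<inter> below ?m (nc_max ?m)))"
    by (rule collapsible_star_union_below[where w = 1])
      (use assms(1) nc_max_in_NC[of ?m] in \<open>auto simp: block_rel_nc_max\<close>)
  then have "collapsible K"
    unfolding assms(3) avoiding_complex_eq_star_union[OF NC assms(1)] .
  then have "contractible_complex K" using K_complex by (rule contractible_collapsible)
  then show ?thesis using link_complex K_complex sub by (simp add: subcomplex_def)
qed

end
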